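(* Let $b$ be a locally integrable function on $\mathbb{R}^n$ and let $0<\beta<1$. Then the following assertions are equivalent: (1) $b\in \dot{\Lambda}_{\beta}(\mathbb{R}^n)$ and $b\ge 0$. (2) $[b,M]$ is bounded from $L^{p(\cdot)}(\mathbb{R}^n)$ to $L^{q(\cdot)}(\mathbb{R}^n)$ for all $(p(\cdot),q(\cdot))\in \mathscr{B}_{p,q}^{\beta}(\mathbb{R}^n)$. (3) $[b,M]$ is bounded from $L^{p(\cdot)}(\mathbb{R}^n)$ to $L^{q(\cdot)}(\mathbb{R}^n)$ for some $(p(\cdot),q(\cdot))\in \mathscr{B}_{p,q}^{\beta}(\mathbb{R}^n)$. (4) There exists some $(p(\cdot),q(\cdot))\in \mathscr{B}_{p,q}^{\beta}(\mathbb{R}^n)$ such that $$\sup_{Q} \frac1{|Q|^{\beta/n}}\frac{\|(b-M_{Q}(b))\chi_{Q}\|_{L^{q(\cdot)}(\mathbb{R}^n)}}{\|\chi_{Q}\|_{L^{q(\cdot)}(\mathbb{R}^n)}} <\infty.$$ (5) For all $(p(\cdot),q(\cdot))\in \mathscr{B}_{p,q}^{\beta}(\mathbb{R}^n)$, $$\sup_{Q} \frac1{|Q|^{\beta/n}}\frac{\|(b-M_{Q}(b))\chi_{Q}\|_{L^{q(\cdot)}(\mathbb{R}^n)}}{\|\chi_{Q}\|_{L^{q(\cdot)}(\mathbb{R}^n)}} <\infty.$$ In (4) and (5) the suprema are over all cubes $Q\subset\mathbb{R}^n$.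
   Context: Functions are real-valued and identified when equal almost everywhere; in particular $b\in\dot{\Lambda}_\beta(\mathbb{R}^n)$ means that $b$ agrees a.e. with a function satisfying the condition below, and $b\ge0$ is understood a.e. A cube $Q\subset\mathbb{R}^n$ always has sides parallel to the coordinate axes; $|Q|$ is its Lebesgue measure and $\chi_Q$ its characteristic function. Lipschitz space: for $0<\beta<1$, $b\in\dot{\Lambda}_{\beta}(\mathbb{R}^n)$ if there is a constant $C$ with $|b(x)-b(y)|\le C|x-y|^{\beta}$ for all $x,y\in\mathbb{R}^n$. Hardy-Littlewood maximal function: $M(f)(x)=\sup_{Q\ni x}\frac1{|Q|}\int_Q|f(y)|\,dy$, the supremum over all cubes $Q\subset\mathbb{R}^n$ containing $x$. For a fixed cube $Q_0$, $M_{Q_0}(f)(x)=\sup\frac1{|Q|}\int_Q|f(y)|\,dy$, the supremum over all cubes $Q$ with $x\in Q\subseteq Q_0$. The (nonlinear) commutator of $M$ with $b$ is $[b,M](f)=bM(f)-M(bf)$. Variable exponent Lebesgue space: for measurable $p(\cdot):\mathbb{R}^n\to[1,\infty)$, $L^{p(\cdot)}(\mathbb{R}^n)$ is the set of measurable $f$ with $\int_{\mathbb{R}^n}(|f(x)|/\lambda)^{p(x)}dx<\infty$ for some $\lambda>0$, with norm $\|f\|_{L^{p(\cdot)}(\mathbb{R}^n)}=\inf\{\lambda>0:\int_{\mathbb{R}^n}(|f(x)|/\lambda)^{p(x)}dx\le1\}$ (equal to $\infty$ if $f\notin L^{p(\cdot)}(\mathbb{R}^n)$). An operator $T$ is bounded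 from $L^{p(\cdot)}(\mathbb{R}^n)$ to $L^{q(\cdot)}(\mathbb{R}^n)$ if there is a constant $C$ such that, for all $f\in L^{p(\cdot)}(\mathbb{R}^n)$, $Tf$ is defined a.e. and $\|Tf\|_{L^{q(\cdot)}(\mathbb{R}^n)}\le C\|f\|_{L^{p(\cdot)}(\mathbb{R}^n)}$. $\mathscr{P}(\mathbb{R}^n)$ is the set of measurable $p(\cdot):\mathbb{R}^n\to[1,\infty)$ with $1<p_-:=\operatorname{ess\,inf}_{x}p(x)$ and $p_+:=\operatorname{ess\,sup}_{x}p(x)<\infty$. $\mathscr{B}(\mathbb{R}^n)$ is the set of $p(\cdot)\in\mathscr{P}(\mathbb{R}^n)$ such that $M$ is bounded on $L^{p(\cdot)}(\mathbb{R}^n)$. An ordered pair $(p(\cdot),q(\cdot))$ of variable exponents belongs to $\mathscr{B}^{\alpha}_{p,q}(\mathbb{R}^n)$ if $p(\cdot)\in\mathscr{P}(\mathbb{R}^n)$, $0<\alpha<n/p_+$, $1/q(\cdot)=1/p(\cdot)-\alpha/n$, and $q(\cdot)(n-\alpha)/n\in\mathscr{B}(\mathbb{R}^n)$. *)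

theory Defs
  imports "HOL-Analysis.Analysis" "HOL-Probability.Essential_Supremum"
begin

text \<open>Measurability and "almost everywhere" refer to Lebesgue (not Borel) measure.\<close>

definition locally_integrable :: "(real^'n \<Rightarrow> real) \<Rightarrow> bool" where
  "locally_integrable b \<longleftrightarrow> (\<forall>K. compact K \<longrightarrow> set_integrable lebesgue K b)"

definition Lipschitz_space :: "real \<Rightarrow> (real^'n \<Rightarrow> real) set" where
  "Lipschitz_space \<beta> = {b. \<exists>g. (AE x in lebesgue. b x = g x) \<and>
     (\<exists>C. \<forall>x y. \<bar>g x - g y\<bar> \<le> C * norm (x - y) powr \<beta>)}"

text \<open>Cubes are nondegenerate and taken open. Taking them closed leaves \<open>maximal f\<close> unchanged for
  locally integrable \<open>f\<close>, and changes \<open>local_maximal Q f\<close> at most on the boundary of \<open>Q\<close>.\<close>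

definition cubes :: "(real^'n) set set" where
  "cubes = {box a (a + vec l) | a l. 0 < l}"

definition average :: "(real^'n \<Rightarrow> real) \<Rightarrow> (real^'n) set \<Rightarrow> ennreal" where
  "average f Q = (\<integral>\<^sup>+y\<in>Q. ennreal \<bar>f y\<bar> \<partial>lebesgue) / emeasure lebesgue Q"

definition maximal :: "(real^'n \<Rightarrow> real) \<Rightarrow> real^'n \<Rightarrow> ennreal" where
  "maximal f x = (SUP Q\<in>{Q \<in> cubes. x \<in> Q}. average f Q)"

definition local_maximal :: "(real^'n) set \<Rightarrow> (real^'n \<Rightarrow> real) \<Rightarrow> real^'n \<Rightarrow> ennreal" where
  "local_maximal Q\<^sub>0 f x = (SUP Q\<in>{Q \<in> cubes. x \<in> Q \<and> Q \<subseteq> Q\<^sub>0}. average f Q)"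

text \<open>Operators take extended real values; the value at a point counts as defined only if it is
  finite. Since \<open>\<infinity> - \<infinity> = \<infinity>\<close> in \<^typ>\<open>ereal\<close>, the commutator below is infinite, hence
  undefined, at every point where \<open>b M(f)\<close> or \<open>M(b f)\<close> is infinite.\<close>

definition commutator :: "(real^'n \<Rightarrow> real) \<Rightarrow> (real^'n \<Rightarrow> real) \<Rightarrow> real^'n \<Rightarrow> ereal" where
  "commutator b f x =
     ereal (b x) * enn2ereal (maximal f x) - enn2ereal (maximal (\<lambda>y. b y * f y) x)"

definition modular :: "(real^'n \<Rightarrow> real) \<Rightarrow> (real^'n \<Rightarrow> real) \<Rightarrow> ennreal" where
  "modular p f = (\<integral>\<^sup>+x. ennreal (\<bar>f x\<bar> powr p x) \<partial>lebesgue)"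

definition Lvar :: "(real^'n \<Rightarrow> real) \<Rightarrow> (real^'n \<Rightarrow> real) set" where
  "Lvar p = {f \<in> borel_measurable lebesgue. \<exists>r>0. modular p (\<lambda>x. f x / r) < \<infinity>}"

definition Lvar_norm :: "(real^'n \<Rightarrow> real) \<Rightarrow> (real^'n \<Rightarrow> real) \<Rightarrow> ennreal" where
  "Lvar_norm p f =
     (if f \<in> Lvar p then (INF r\<in>{r. 0 < r \<and> modular p (\<lambda>x. f x / r) \<le> 1}. ennreal r) else \<infinity>)"

definition bounded_operator ::
    "((real^'n \<Rightarrow> real) \<Rightarrow> real^'n \<Rightarrow> ereal) \<Rightarrow> (real^'n \<Rightarrow> real) \<Rightarrow> (real^'n \<Rightarrow> real) \<Rightarrow> bool" where
  "bounded_operator T p q \<longleftrightarrow>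
     (\<exists>C::real. \<forall>f\<in>Lvar p. (AE x in lebesgue. \<bar>T f x\<bar> \<noteq> \<infinity>) \<and>
        Lvar_norm q (\<lambda>x. real_of_ereal (T f x)) \<le> ennreal C * Lvar_norm p f)"

definition exponent_inf :: "(real^'n \<Rightarrow> real) \<Rightarrow> ereal" where
  "exponent_inf p = Sup {z. AE x in lebesgue. z \<le> ereal (p x)}"

definition exponent_sup :: "(real^'n \<Rightarrow> real) \<Rightarrow> ereal" where
  "exponent_sup p = esssup lebesgue (\<lambda>x. ereal (p x))"

definition exponents :: "(real^'n \<Rightarrow> real) set" where
  "exponents = {p \<in> borel_measurable lebesgue. (\<forall>x. 1 \<le> p x) \<and>
     1 < exponent_inf p \<and> exponent_sup p < \<infinity>}"

definition maximal_exponents :: "(real^'n \<Rightarrow> real) set" where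
  "maximal_exponents =
     {p \<in> exponents. bounded_operator (\<lambda>f x. enn2ereal (maximal f x)) p p}"

text \<open>The relation between \<open>p\<close> and \<open>q\<close> is an identity of functions modulo null sets.\<close>

definition exponent_pairs :: "real \<Rightarrow> ((real^'n \<Rightarrow> real) \<times> (real^'n \<Rightarrow> real)) set" where
  "exponent_pairs \<alpha> = {(p, q). p \<in> exponents \<and>
     0 < \<alpha> \<and> ereal \<alpha> < ereal (real CARD('n)) / exponent_sup p \<and>
     (AE x in lebesgue. 1 / q x = 1 / p x - \<alpha> / real CARD('n)) \<and>
     (\<lambda>x. q x * (real CARD('n) - \<alpha>) / real CARD('n)) \<in> maximal_exponents}"

text \<open>For locally integrable \<open>b\<close>, \<open>local_maximal Q b\<close> is finite almost everywhere on \<open>Q\<close>, so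
  \<open>enn2real\<close> alters the function only on a null set. Also \<open>0 < Lvar_norm q (indicator Q) < \<infinity>\<close>
  for the exponents \<open>q\<close> in use, so the division is proper.\<close>

definition oscillation :: "real \<Rightarrow> (real^'n \<Rightarrow> real) \<Rightarrow> (real^'n \<Rightarrow> real) \<Rightarrow> ennreal" where
  "oscillation \<beta> q b = (SUP Q\<in>cubes.
     ennreal (1 / measure lebesgue Q powr (\<beta> / real CARD('n))) *
     (Lvar_norm q (\<lambda>x. (b x - enn2real (local_maximal Q b x)) * indicator Q x) /
      Lvar_norm q (indicator Q)))"

end

theory Submission
  imports Defs
begin

text \<open>If \<open>b \<ge> 0\<close> is Lipschitz, then \<open>\<bar>[b, M] f\<bar>\<close> is dominated by the fractional maximal function of
  order \<open>\<beta>\<close>, and a Hedberg-type inequality reduces the latter to the boundedness of \<open>M\<close> on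
  \<open>L\<^sup>s\<close> with \<open>s = q (n - \<beta>) / n\<close>. Testing the commutator on \<open>\<chi>\<^sub>Q\<close>, where
  \<open>M (b \<chi>\<^sub>Q) = M\<^sub>Q b\<close> on \<open>Q\<close>, gives the oscillation condition. Conversely the oscillation
  condition bounds the averages of \<open>b - M\<^sub>Q b\<close> over \<open>Q\<close> by \<open>\<bar>Q\<bar> powr (\<beta> / n)\<close>; since \<open>M\<^sub>Q b\<close> dominates
  the mean of \<open>b\<close> over \<open>Q\<close>, it controls the negative part of \<open>b\<close> minus its mean, hence the mean
  oscillation, and Campanato's theorem applies. Shrinking cubes at a point where \<open>b\<close> is negative
  would contradict the same bound. Assertions (2) and (3) differ by the existence of a pair of exponents,
  for which constants with \<open>s = 2\<close> serve.\<close>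

section \<open>Cubes, averages and maximal functions\<close>

text \<open>A pair in \<open>exponent_pairs\<close> provides a bound for M only on the intermediate
  exponent s = q (1 - \<theta>), with \<theta> = \<beta> / n; nothing is given about M on L^p or on
  dual exponents. So everything passes through powers: 1/q = 1/p - \<theta> gives p/q + p \<theta> =
  1, and Hoelder's and Young's inequalities with weights 1 - \<theta> and \<theta> move between p, q
  and s at the level of modulars. The bound on L^s is applied to |f|^(p/s) for the upper estimate,
  and to |g|^(1/(1 - \<theta>)) to weigh averages against norms of characteristic functions. Two
  obstacles shape the rest. The commutator need not be finite where M f is infinite; finiteness of M
  f almost everywhere comes from the weak type inequality on balls for small cubes and from the
  fractional bound for large ones. And b is known only up to null sets, so the Campanato argument
  gives a Hoelder estimate off a null set, from which a McShane extension produces the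
  representative.\<close>

lemma cubesE:
  assumes "Q \<in> cubes"
  obtains a l where "Q = box a (a + vec l)" "0 < l"
  using assms unfolding cubes_def by auto

lemma box_vec_in_cubes: "0 < l \<Longrightarrow> box a (a + vec l) \<in> cubes"
  unfolding cubes_def by auto

lemma open_cube: "Q \<in> cubes \<Longrightarrow> open Q"
  by (auto elim!: cubesE)

lemma measure_box_vec:
  fixes a :: "real^'n"
  assumes "0 \<le> l"
  shows "measure lebesgue (box a (a + vec l)) = l ^ CARD('n)"
proof -
  have "cbox a (a + vec l) \<noteq> {}"
    using assms by (auto simp: interval_ne_empty_cart)
  then have "measure lborel (cbox a (a + vec l)) = (\<Prod>i\<in>UNIV. (a + vec l) $ i - a $ i)"
    by (rule content_cbox_cart)
  then show ?thesis
    by (simp add: measure_lborel_box_eq measure_lborel_cbox_eq)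
qed

lemma sets_cube: "Q \<in> cubes \<Longrightarrow> Q \<in> sets lebesgue"
  by (simp add: open_cube borel_open)

lemma bounded_cube: "Q \<in> cubes \<Longrightarrow> bounded Q"
  by (auto elim!: cubesE)

lemma lmeasurable_cube: "Q \<in> cubes \<Longrightarrow> Q \<in> lmeasurable"
  by (simp add: bounded_cube open_cube lmeasurable_open)

lemma emeasure_cube:
  assumes "Q \<in> cubes"
  shows "emeasure lebesgue Q = ennreal (measure lebesgue Q)"
  by (meson assms emeasure_eq_measure2 lmeasurable_cube)

lemma measure_cube_pos: "Q \<in> cubes \<Longrightarrow> 0 < measure lebesgue Q"
  by (metis cubesE less_imp_le measure_box_vec zero_less_power)

lemma emeasure_cube_neq [simp]:
  assumes "Q \<in> cubes"
  shows "emeasure lebesgue Q \<noteq> 0" "emeasure lebesgue Q \<noteq> \<infinity>"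
  using measure_cube_pos[OF assms] by (auto simp: emeasure_cube[OF assms])

lemma norm_diff_box_vec:
  fixes a :: "real^'n" and l :: real
  assumes "x \<in> box a (a + vec l)" "y \<in> box a (a + vec l)"
  shows "norm (x - y) \<le> CARD('n) * l"
proof -
  have "norm (x - y) \<le> (\<Sum>i\<in>UNIV. \<bar>(x - y) $ i\<bar>)"
    by (rule norm_le_l1_cart)
  also have "\<dots> \<le> real CARD('n) * l"
  proof (rule sum_bounded_above[of UNIV, simplified])
    fix i
    show "\<bar>(x - y) $ i\<bar> \<le> l"
      using assms by (simp add: mem_box_cart) (smt (verit))
  qed
  finally show ?thesis .
qed

lemma cube_around:
  fixes x :: "real^'n"
  assumes "0 < l"
  shows "\<exists>Q\<in>cubes. x \<in> Q \<and> measure lebesgue Q = l ^ CARD('n)"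
proof -
  have "x \<in> box (x - vec (l/2)) (x - vec (l/2) + vec l)"
    using assms by (auto simp: mem_box_cart)
  with assms show ?thesis
    using box_vec_in_cubes measure_box_vec less_imp_le by metis
qed

lemma average_le_maximal: "Q \<in> cubes \<Longrightarrow> x \<in> Q \<Longrightarrow> average f Q \<le> maximal f x"
  unfolding maximal_def by (rule SUP_upper) auto

lemma average_le_local_maximal:
  "Q \<in> cubes \<Longrightarrow> x \<in> Q \<Longrightarrow> Q \<subseteq> Q0 \<Longrightarrow> average f Q \<le> local_maximal Q0 f x"
  unfolding local_maximal_def by (rule SUP_upper) auto

lemma average_mono:
  assumes "\<And>y. y \<in> Q \<Longrightarrow> \<bar>f y\<bar> \<le> \<bar>g y\<bar>"
  shows "average f Q \<le> average g Q"
  unfolding average_def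
  by (intro divide_right_mono_ennreal nn_integral_mono)
     (auto simp: indicator_def assms intro: ennreal_leI)

lemma average_cong:
  assumes "\<And>y. y \<in> Q \<Longrightarrow> f y = g y"
  shows "average f Q = average g Q"
  using assms by (intro antisym average_mono) auto

lemma average_mult_emeasure:
  assumes "Q \<in> cubes"
  shows "average f Q * ennreal (measure lebesgue Q) = (\<integral>\<^sup>+y\<in>Q. ennreal \<bar>f y\<bar> \<partial>lebesgue)"
  unfolding average_def using emeasure_cube_neq[OF assms]
  by (simp add: emeasure_cube[OF assms, symmetric] ennreal_divide_times ennreal_times_divide
      ennreal_mult_divide_eq)

lemma average_le_iff:
  assumes "Q \<in> cubes" "0 \<le> c"
  shows "average f Q \<le> ennreal c \<longleftrightarrow>
    (\<integral>\<^sup>+y\<in>Q. ennreal \<bar>f y\<bar> \<partial>lebesgue) \<le> ennreal (c * measure lebesgue Q)"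
proof -
  have m: "0 < measure lebesgue Q"
    by (rule measure_cube_pos[OF assms(1)])
  have "average f Q \<le> ennreal c \<longleftrightarrow>
      ennreal (measure lebesgue Q) * average f Q \<le> ennreal (measure lebesgue Q) * ennreal c"
    using m by (subst ennreal_mult_le_mult_iff) auto
  then show ?thesis
    using assms m unfolding average_mult_emeasure[OF assms(1), symmetric]
    by (simp add: ennreal_mult mult.commute)
qed

text \<open>Open cubes make M f lower semicontinuous whatever f is: each superlevel set is a union
  of cubes.\<close>

lemma borel_measurable_maximal [measurable]:
  fixes f :: "real^'n \<Rightarrow> real"
  shows "maximal f \<in> borel_measurable borel"
proof (rule borel_measurableI_greater)
  fix t
  have "{x \<in> space borel. t < maximal f x} = \<Union>{Q \<in> cubes. t < average f Q}"
    by (auto simp: maximal_def less_SUP_iff)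
  moreover have "open (\<Union>{Q \<in> cubes. t < average f Q})"
    by (rule open_Union) (auto intro: open_cube)
  ultimately show "{x \<in> space borel. t < maximal f x} \<in> sets borel"
    by simp
qed

lemma borel_measurable_local_maximal [measurable]:
  fixes f :: "real^'n \<Rightarrow> real"
  shows "local_maximal Q0 f \<in> borel_measurable borel"
proof (rule borel_measurableI_greater)
  fix t
  have "{x \<in> space borel. t < local_maximal Q0 f x} = \<Union>{Q \<in> cubes. Q \<subseteq> Q0 \<and> t < average f Q}"
    by (auto simp: local_maximal_def less_SUP_iff)
  moreover have "open (\<Union>{Q \<in> cubes. Q \<subseteq> Q0 \<and> t < average f Q})"
    by (rule open_Union) (auto intro: open_cube)
  ultimately show "{x \<in> space borel. t < local_maximal Q0 f x} \<in> sets borel"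
    by simp
qed

lemma borel_measurable_maximal_lebesgue [measurable]:
  "maximal f \<in> borel_measurable lebesgue"
  "local_maximal Q f \<in> borel_measurable lebesgue"
  by (simp_all add: borel_measurable_maximal borel_measurable_local_maximal measurable_completion)

section \<open>Variable exponent norms\<close>

text \<open>Hoelder's inequality for the exponents 1/(1 - \<theta>) and 1/\<theta>. Real upper
  bounds a and b replace the two integrals, so that powers are taken of reals only. The proof
  integrates Young's inequality for A/a and B/b.\<close>

lemma nn_integral_Holder_bound:
  fixes A B :: "'a \<Rightarrow> real"
  assumes [measurable]: "A \<in> borel_measurable M" "B \<in> borel_measurable M"
    and A: "\<And>x. 0 \<le> A x" and B: "\<And>x. 0 \<le> B x"
    and \<theta>: "0 < \<theta>" "\<theta> < 1"
    and a: "0 \<le> a" "(\<integral>\<^sup>+x. ennreal (A x) \<partial>M) \<le> ennreal a"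
    and b: "0 \<le> b" "(\<integral>\<^sup>+x. ennreal (B x) \<partial>M) \<le> ennreal b"
  shows "(\<integral>\<^sup>+x. ennreal (A x powr (1 - \<theta>) * B x powr \<theta>) \<partial>M)
    \<le> ennreal (a powr (1 - \<theta>) * b powr \<theta>)"
\<comment> \<open>Normalising by a and b requires both to be positive; otherwise one factor vanishes
  almost everywhere.\<close>
proof (cases "a = 0 \<or> b = 0")
  case True
  then have "AE x in M. A x = 0 \<or> B x = 0"
  proof
    assume "a = 0"
    with a A have "AE x in M. A x = 0"
      by (simp add: nn_integral_0_iff_AE order_antisym)
    then show ?thesis by eventually_elim simp
  next
    assume "b = 0"
    with b B have "AE x in M. B x = 0"
      by (simp add: nn_integral_0_iff_AE order_antisym)
    then show ?thesis by eventually_elim simp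
  qed
  then have "(\<integral>\<^sup>+x. ennreal (A x powr (1 - \<theta>) * B x powr \<theta>) \<partial>M) = (\<integral>\<^sup>+x. 0 \<partial>M)"
    by (intro nn_integral_cong_AE) (auto elim!: eventually_mono)
  then show ?thesis by simp
next
  case False
  with a b have pos: "0 < a" "0 < b" by auto
  let ?c = "a powr (1 - \<theta>) * b powr \<theta>"
  have young: "A x powr (1 - \<theta>) * B x powr \<theta> \<le> ?c * ((1 - \<theta>) / a * A x + \<theta> / b * B x)" for x
  proof (cases "A x = 0 \<or> B x = 0")
    case True
    have "0 \<le> ?c * ((1 - \<theta>) / a * A x + \<theta> / b * B x)"
      using pos A B \<theta> by simp
    with True show ?thesis by auto
  next
    case False
    then have "0 < A x" "0 < B x" using A[of x] B[of x] by auto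
    then have "(A x / a) powr (1 - \<theta>) * (B x / b) powr \<theta> \<le> (1 - \<theta>) * (A x / a) + \<theta> * (B x / b)"
      using pos \<theta> by (intro Youngs_inequality_0) auto
    with pos \<open>0 < A x\<close> \<open>0 < B x\<close> show ?thesis
      by (simp add: powr_divide field_simps)
  qed
  have "(\<integral>\<^sup>+x. ennreal (A x powr (1 - \<theta>) * B x powr \<theta>) \<partial>M)
      \<le> (\<integral>\<^sup>+x. ennreal ?c * (ennreal ((1 - \<theta>) / a) * ennreal (A x) + ennreal (\<theta> / b) * ennreal (B x)) \<partial>M)"
  proof (rule nn_integral_mono)
    fix x
    have "ennreal (?c * ((1 - \<theta>) / a * A x + \<theta> / b * B x)) =
        ennreal ?c * (ennreal ((1 - \<theta>) / a) * ennreal (A x) + ennreal (\<theta> / b) * ennreal (B x))"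
      using pos \<theta> A[of x] B[of x]
      by (simp add: ennreal_mult[symmetric] ennreal_plus[symmetric] del: ennreal_plus)
    with young[of x] show "ennreal (A x powr (1 - \<theta>) * B x powr \<theta>) \<le>
        ennreal ?c * (ennreal ((1 - \<theta>) / a) * ennreal (A x) + ennreal (\<theta> / b) * ennreal (B x))"
      by (metis ennreal_leI)
  qed
  also have "\<dots> = ennreal ?c * (ennreal ((1 - \<theta>) / a) * (\<integral>\<^sup>+x. ennreal (A x) \<partial>M)
      + ennreal (\<theta> / b) * (\<integral>\<^sup>+x. ennreal (B x) \<partial>M))"
    by (simp add: nn_integral_cmult nn_integral_add)
  also have "\<dots> \<le> ennreal ?c * (ennreal ((1 - \<theta>) / a) * ennreal a + ennreal (\<theta> / b) * ennreal b)"
    by (intro mult_left_mono add_mono a b) auto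
  also have "\<dots> = ennreal ?c"
    using pos \<theta> by (simp add: ennreal_mult[symmetric] ennreal_plus[symmetric] del: ennreal_plus)
  finally show ?thesis .
qed

lemma modular_mono_AE:
  assumes "\<And>x. 0 \<le> p x" "AE x in lebesgue. \<bar>f x\<bar> \<le> \<bar>g x\<bar>"
  shows "modular p f \<le> modular p g"
  unfolding modular_def using assms
  by (intro nn_integral_mono_AE) (auto elim!: eventually_mono intro!: ennreal_leI powr_mono2)

text \<open>Since p >= 1 and K >= 1, K <= K powr p x at every point: dividing the argument by K
  shrinks the modular at least linearly. This brings a finite modular below 1.\<close>

lemma modular_divide_le:
  assumes [measurable]: "p \<in> borel_measurable lebesgue" "f \<in> borel_measurable lebesgue"
    and p: "\<And>x. 1 \<le> p x" and "1 \<le> K"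
  shows "ennreal K * modular p (\<lambda>x. f x / (r * K)) \<le> modular p (\<lambda>x. f x / r)"
proof -
  have "ennreal K * modular p (\<lambda>x. f x / (r * K))
      = (\<integral>\<^sup>+x. ennreal K * ennreal (\<bar>f x / (r * K)\<bar> powr p x) \<partial>lebesgue)"
    unfolding modular_def by (rule nn_integral_cmult[symmetric]) simp
  also have "\<dots> \<le> modular p (\<lambda>x. f x / r)"
    unfolding modular_def
  proof (rule nn_integral_mono)
    fix x
    have "\<bar>f x / r\<bar> powr p x = \<bar>f x / (r * K)\<bar> powr p x * K powr p x"
      using \<open>1 \<le> K\<close> by (simp add: powr_mult[symmetric] abs_mult)
    moreover have "K \<le> K powr p x"
      using powr_mono[OF p[of x] \<open>1 \<le> K\<close>] \<open>1 \<le> K\<close> by simp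
    ultimately have "K * \<bar>f x / (r * K)\<bar> powr p x \<le> \<bar>f x / r\<bar> powr p x"
      by (metis mult.commute mult_right_mono powr_ge_zero)
    then show "ennreal K * ennreal (\<bar>f x / (r * K)\<bar> powr p x) \<le> ennreal (\<bar>f x / r\<bar> powr p x)"
      using \<open>1 \<le> K\<close> by (simp add: ennreal_mult'[symmetric] ennreal_leI)
  qed
  finally show ?thesis .
qed

lemma Lvar_modular_le_1:
  assumes [measurable]: "p \<in> borel_measurable lebesgue"
    and p: "\<And>x. 1 \<le> p x" and f: "f \<in> Lvar p"
  obtains r where "0 < r" "modular p (\<lambda>x. f x / r) \<le> 1"
proof -
  from f have [measurable]: "f \<in> borel_measurable lebesgue" by (simp add: Lvar_def)
  from f obtain r where r: "0 < r" "modular p (\<lambda>x. f x / r) < \<infinity>" by (auto simp: Lvar_def)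
  define m where "m = enn2real (modular p (\<lambda>x. f x / r))"
  have m: "modular p (\<lambda>x. f x / r) = ennreal m" "0 \<le> m"
    using r by (simp_all add: m_def)
  have "ennreal (m + 1) * modular p (\<lambda>x. f x / (r * (m + 1))) \<le> ennreal m"
    using modular_divide_le[of p f "m + 1" r] p m by simp
  also have "\<dots> \<le> ennreal (m + 1) * 1" using m by (simp del: ennreal_plus add: ennreal_leI)
  finally have "modular p (\<lambda>x. f x / (r * (m + 1))) \<le> 1"
    using m by (subst (asm) ennreal_mult_le_mult_iff) (auto simp del: ennreal_plus)
  with that[of "r * (m + 1)"] r m show ?thesis by simp
qed

lemma Lvar_modularI:
  assumes "f \<in> borel_measurable lebesgue" "0 < r" "modular p (\<lambda>x. f x / r) \<le> 1"
  shows "f \<in> Lvar p"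
proof -
  have "modular p (\<lambda>x. f x / r) < \<infinity>"
    using assms(3) by (rule order.strict_trans1) simp
  with assms show ?thesis by (auto simp: Lvar_def)
qed

lemma Lvar_normI:
  assumes "f \<in> borel_measurable lebesgue" "0 < r" "modular p (\<lambda>x. f x / r) \<le> 1"
  shows "Lvar_norm p f \<le> ennreal r"
proof -
  have "f \<in> Lvar p"
    using assms by (rule Lvar_modularI)
  with assms show ?thesis
    unfolding Lvar_norm_def by (auto intro: INF_lower)
qed

text \<open>The strict inequality selects an admissible r below R, so attainment of the infimum
  never enters; monotonicity of the modular then leads from r to R.\<close>

lemma Lvar_norm_less:
  assumes p: "\<And>x. 0 \<le> p x" and "Lvar_norm p f < ennreal R"
  shows "modular p (\<lambda>x. f x / R) \<le> 1" "f \<in> Lvar p"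
proof -
  from assms(2) show f: "f \<in> Lvar p"
    by (auto simp: Lvar_norm_def split: if_splits)
  with assms(2) obtain r where r: "0 < r" "modular p (\<lambda>x. f x / r) \<le> 1" "ennreal r < ennreal R"
    by (auto simp: Lvar_norm_def INF_less_iff)
  then have "r < R" using ennreal_less_iff by auto
  have "modular p (\<lambda>x. f x / R) \<le> modular p (\<lambda>x. f x / r)"
    using r \<open>r < R\<close> by (intro modular_mono_AE p AE_I2) (auto simp: abs_divide frac_le)
  with r show "modular p (\<lambda>x. f x / R) \<le> 1" by simp
qed

text \<open>Reduces a norm inequality to an implication between modular unit balls, uniform in the
  scale r. The norm estimates for M, for the commutator and for characteristic functions take this
  route.\<close>

lemma Lvar_norm_le_mult:
  assumes "0 < C" "f \<in> Lvar p" and [measurable]: "g \<in> borel_measurable lebesgue"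
    and *: "\<And>r. 0 < r \<Longrightarrow> modular p (\<lambda>x. f x / r) \<le> 1 \<Longrightarrow> modular q (\<lambda>x. g x / (C * r)) \<le> 1"
  shows "Lvar_norm q g \<le> ennreal C * Lvar_norm p f"
proof -
  have "Lvar_norm q g / ennreal C \<le> Lvar_norm p f"
    unfolding Lvar_norm_def[of p] if_P[OF assms(2)]
  proof (rule INF_greatest, clarify)
    fix r :: real assume r: "0 < r" "modular p (\<lambda>x. f x / r) \<le> 1"
    have "Lvar_norm q g \<le> ennreal (C * r)"
      using r \<open>0 < C\<close> by (intro Lvar_normI *) auto
    then show "Lvar_norm q g / ennreal C \<le> ennreal r"
      using \<open>0 < C\<close> r by (intro divide_le_posI_ennreal) (auto simp: ennreal_mult mult.commute)
  qed
  then have "ennreal C * (Lvar_norm q g / ennreal C) \<le> ennreal C * Lvar_norm p f"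
    by (rule mult_left_mono) simp
  then show ?thesis
    using \<open>0 < C\<close>
    by (simp add: ennreal_times_divide mult.commute[of "ennreal C"] ennreal_mult_divide_eq)
qed

lemma Lvar_norm_mono:
  assumes p: "\<And>x. 0 \<le> p x" and [measurable]: "g \<in> borel_measurable lebesgue"
    and gf: "AE x in lebesgue. \<bar>g x\<bar> \<le> \<bar>f x\<bar>"
  shows "Lvar_norm p g \<le> Lvar_norm p f"
proof (cases "f \<in> Lvar p")
  case True
  have "modular p (\<lambda>x. g x / (1 * r)) \<le> 1" if "0 < r" "modular p (\<lambda>x. f x / r) \<le> 1" for r
  proof -
    have "modular p (\<lambda>x. g x / r) \<le> modular p (\<lambda>x. f x / r)"
      using gf \<open>0 < r\<close>
      by (intro modular_mono_AE p) (auto elim!: eventually_mono simp: abs_divide divide_right_mono)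
    with that show ?thesis by simp
  qed
  then have "Lvar_norm p g \<le> ennreal 1 * Lvar_norm p f"
    by (intro Lvar_norm_le_mult True) auto
  then show ?thesis by simp
qed (simp add: Lvar_norm_def)

lemma bounded_operator_modular:
  assumes q: "\<And>x. 0 \<le> q x" and "bounded_operator T p q"
  shows "\<exists>C>0. (\<forall>f\<in>Lvar p. AE x in lebesgue. \<bar>T f x\<bar> \<noteq> \<infinity>) \<and>
    (\<forall>f\<in>borel_measurable lebesgue. \<forall>r>0. modular p (\<lambda>x. f x / r) \<le> 1 \<longrightarrow>
      modular q (\<lambda>x. real_of_ereal (T f x) / (C * r)) \<le> 1)"
proof -
  from assms(2) obtain C where C: "\<And>f. f \<in> Lvar p \<Longrightarrow> AE x in lebesgue. \<bar>T f x\<bar> \<noteq> \<infinity>"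
      "\<And>f. f \<in> Lvar p \<Longrightarrow> Lvar_norm q (\<lambda>x. real_of_ereal (T f x)) \<le> ennreal C * Lvar_norm p f"
    unfolding bounded_operator_def by blast
  show ?thesis
  \<comment> \<open>\<open>C\<close> may be negative, hence the maximum; the added 1 makes the
    inequality strict, as \<open>Lvar_norm_less\<close> demands.\<close>
  proof (intro exI[of _ "max C 0 + 1"] conjI ballI allI impI)
    fix f r assume f: "f \<in> borel_measurable lebesgue" "0 < r" "modular p (\<lambda>x. f x / r) \<le> 1"
    have "f \<in> Lvar p" using f by (rule Lvar_modularI)
    then have "Lvar_norm q (\<lambda>x. real_of_ereal (T f x)) \<le> ennreal C * Lvar_norm p f"
      by (rule C)
    also have "\<dots> \<le> ennreal (max C 0) * ennreal r"
      by (intro mult_mono Lvar_normI f) (auto intro: ennreal_leI)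
    also have "\<dots> = ennreal (max C 0 * r)" using f by (simp add: ennreal_mult)
    also have "\<dots> < ennreal ((max C 0 + 1) * r)"
      using f by (intro ennreal_lessI) (auto simp: distrib_right add_nonneg_pos)
    finally show "modular q (\<lambda>x. real_of_ereal (T f x) / ((max C 0 + 1) * r)) \<le> 1"
      by (rule Lvar_norm_less[OF q])
  qed (use C in auto)
qed

section \<open>The Hardy-Littlewood maximal theorem\<close>

lemma sigma_finite_lebesgue: "sigma_finite_measure (lebesgue :: 'a::euclidean_space measure)"
proof
  show "\<exists>A::'a set set. countable A \<and> A \<subseteq> sets lebesgue \<and> \<Union>A = space lebesgue \<and>
      (\<forall>a\<in>A. emeasure lebesgue a \<noteq> \<infinity>)"
  proof (intro exI conjI ballI)
    show "\<Union>(range (\<lambda>n::nat. cball (0::'a) (real n))) = space lebesgue"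
      by (auto simp: real_arch_simple)
    show "emeasure lebesgue a \<noteq> \<infinity>" if "a \<in> range (\<lambda>n::nat. cball (0::'a) (real n))" for a
      using that by (auto simp: emeasure_cball)
  qed auto
qed

text \<open>A cube of side \<open>l\<close> containing \<open>x\<close> lies in the ball of radius \<open>n l\<close> about \<open>x\<close>, whose volume
  is a fixed multiple of that of the cube; so Vitali's covering lemma for balls applies.\<close>

lemma maximal_weak_type:
  "\<exists>A>0. \<forall>f\<in>borel_measurable lebesgue. \<forall>t>0.
    emeasure lebesgue {x::real^'n. ennreal t < maximal f x}
      \<le> ennreal (A / t) * (\<integral>\<^sup>+x. ennreal \<bar>f x\<bar> \<partial>lebesgue)"
proof -
  define n where "n = CARD('n)"
  have n: "0 < n" by (simp add: n_def)
  \<comment> \<open>The volume of a ball of radius n l divided by that of a cube of side l. The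
    factor \<open>5 ^ n\<close> in \<open>A\<close> is the price of Vitali's enlargement.\<close>
  define \<kappa> where "\<kappa> = unit_ball_vol n * n ^ n"
  have \<kappa>: "0 < \<kappa>" using n by (simp add: \<kappa>_def)
  define A where "A = 5 ^ n * \<kappa>"
  have A: "0 < A" using \<kappa> by (simp add: A_def)
  have "emeasure lebesgue {x. ennreal t < maximal f x} \<le> ennreal (A / t) * (\<integral>\<^sup>+x. ennreal \<bar>f x\<bar> \<partial>lebesgue)"
    if [measurable]: "f \<in> borel_measurable lebesgue" and t: "0 < t" for f :: "real^'n \<Rightarrow> real" and t
  proof (cases "(\<integral>\<^sup>+x. ennreal \<bar>f x\<bar> \<partial>lebesgue) = \<infinity>")
    case True
    then show ?thesis using A t by (simp add: ennreal_mult_top)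
  next
    case False
    define i where "i = enn2real (\<integral>\<^sup>+x. ennreal \<bar>f x\<bar> \<partial>lebesgue)"
    have i: "(\<integral>\<^sup>+x. ennreal \<bar>f x\<bar> \<partial>lebesgue) = ennreal i" "0 \<le> i"
      using False by (simp_all add: i_def less_top)
    define E where "E = {x. ennreal t < maximal f x}"
    define \<nu> where "\<nu> = density lebesgue (\<lambda>x. ennreal \<bar>f x\<bar>)"
    have \<nu>: "emeasure \<nu> S = (\<integral>\<^sup>+x\<in>S. ennreal \<bar>f x\<bar> \<partial>lebesgue)" if "S \<in> sets lebesgue" for S
      unfolding \<nu>_def using that by (subst emeasure_density) auto
    have "\<exists>r. 0 < r \<and> r \<le> n * max 1 (i / t) \<and>
        emeasure lebesgue (cball x r) \<le> ennreal (\<kappa> / t) * emeasure \<nu> (cball x r)" if "x \<in> E" for x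
    proof -
      from that obtain Q where Q: "Q \<in> cubes" "x \<in> Q" "ennreal t < average f Q"
        by (auto simp: E_def maximal_def less_SUP_iff)
      from Q(1) obtain a l where l: "Q = box a (a + vec l)" "0 < l" by (rule cubesE)
      have mQ: "measure lebesgue Q = l ^ n" unfolding l(1) n_def using l by (intro measure_box_vec) auto
      have QB: "Q \<subseteq> cball x (n * l)"
        using norm_diff_box_vec[of x a l] Q l by (auto simp: dist_norm n_def)
      have "ennreal t * ennreal (l ^ n) \<le> average f Q * ennreal (measure lebesgue Q)"
        using Q by (simp add: mQ mult_right_mono)
      also have "\<dots> = emeasure \<nu> Q"
        using Q by (simp add: average_mult_emeasure \<nu> sets_cube)
      finally have 1: "ennreal t * ennreal (l ^ n) \<le> emeasure \<nu> Q" .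
      have "emeasure \<nu> Q \<le> ennreal i"
        unfolding i(1)[symmetric] \<nu>[OF sets_cube[OF Q(1)]]
        by (intro nn_integral_mono) (auto simp: indicator_def)
      with 1 have "ennreal (t * l ^ n) \<le> ennreal i"
        using t l by (simp add: ennreal_mult)
      then have "t * l ^ n \<le> i" using i t l by (simp add: ennreal_le_iff)
      \<comment> \<open>Vitali's lemma needs bounded radii; the finite integral i caps the side of
        every cube on which the average of f exceeds t.\<close>
      then have "l ^ n \<le> i / t" using t by (simp add: field_simps)
      moreover have "l \<le> l ^ n" if "1 \<le> l" using that n by (simp add: self_le_power)
      ultimately have "l \<le> max 1 (i / t)" by linarith
      then have r: "n * l \<le> n * max 1 (i / t)" using n by simp
      have "emeasure lebesgue (cball x (n * l)) = ennreal (\<kappa> * l ^ n)"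
        using n l by (simp add: emeasure_cball \<kappa>_def power_mult_distrib n_def mult.assoc)
      also have "\<dots> = ennreal (\<kappa> / t) * (ennreal t * ennreal (l ^ n))"
        using t \<kappa> l by (simp add: ennreal_mult[symmetric])
      also have "\<dots> \<le> ennreal (\<kappa> / t) * emeasure \<nu> (cball x (n * l))"
      proof (intro mult_left_mono order_trans[OF 1] emeasure_mono[OF QB])
        show "cball x (n * l) \<in> sets \<nu>" by (simp add: \<nu>_def)
      qed simp
      finally show ?thesis
        using r l n by (intro exI[of _ "n * l"]) auto
    qed
    then obtain r where r: "\<And>x. x \<in> E \<Longrightarrow> 0 < r x \<and> r x \<le> n * max 1 (i / t)"
      "\<And>x. x \<in> E \<Longrightarrow> emeasure lebesgue (cball x (r x)) \<le> ennreal (\<kappa> / t) * emeasure \<nu> (cball x (r x))"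
      by metis
    have "E \<subseteq> (\<Union>x\<in>E. cball x (r x))"
      using r(1) by (force simp: less_imp_le)
    note vitali = Vitali_covering_lemma_cballs[where a = "\<lambda>x. x", OF this r(1)]
    obtain C where C: "countable C" "C \<subseteq> E"
      "pairwise (\<lambda>x y. disjnt (cball x (r x)) (cball y (r y))) C"
      "E \<subseteq> (\<Union>x\<in>C. cball x (5 * r x))"
      by (rule vitali)
    define I where "I = to_nat_on C ` C"
    define e where "e = from_nat_into C"
    have e: "e k \<in> C" if "k \<in> I" for k
      using that C(1) by (auto simp: I_def e_def from_nat_into_to_nat_on)
    have e_inj: "e k \<noteq> e j" if "k \<in> I" "j \<in> I" "k \<noteq> j" for k j
      using that C(1) by (auto simp: I_def e_def)
    define X where "X k = (if k \<in> I then cball (e k) (r (e k)) else {})" for k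
    define Y where "Y k = (if k \<in> I then cball (e k) (5 * r (e k)) else {})" for k
    have EY: "E \<subseteq> (\<Union>k. Y k)"
    proof
      fix y assume "y \<in> E"
      with C(4) obtain x where x: "x \<in> C" "y \<in> cball x (5 * r x)" by auto
      then have "y \<in> Y (to_nat_on C x)"
        using C(1) by (simp add: Y_def I_def e_def)
      then show "y \<in> (\<Union>k. Y k)" by blast
    qed
    have X_sets: "range X \<subseteq> sets lebesgue" and Y_sets: "range Y \<subseteq> sets lebesgue"
      by (auto simp: X_def Y_def)
    have disj: "disjoint_family X"
      unfolding disjoint_family_on_def
    proof (intro ballI impI)
      fix k j :: nat assume "k \<noteq> j"
      then show "X k \<inter> X j = {}"
        using C(3) e e_inj[of k j] by (auto simp: X_def pairwise_def disjnt_def)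
    qed
    have YX: "emeasure lebesgue (Y k) \<le> ennreal (A / t) * emeasure \<nu> (X k)" for k
    proof (cases "k \<in> I")
      case True
      then have ek: "e k \<in> E" using e C by auto
      with r have rp: "0 < r (e k)" by auto
      have "emeasure lebesgue (Y k) = ennreal (5 ^ n) * emeasure lebesgue (X k)"
        using rp True
        by (simp add: X_def Y_def emeasure_cball n_def power_mult_distrib ennreal_mult[symmetric] mult_ac)
      also have "\<dots> \<le> ennreal (5 ^ n) * (ennreal (\<kappa> / t) * emeasure \<nu> (X k))"
        using r(2)[OF ek] True by (intro mult_left_mono) (auto simp: X_def)
      also have "\<dots> = ennreal (A / t) * emeasure \<nu> (X k)"
        using \<kappa> t by (simp add: mult.assoc[symmetric] ennreal_mult[symmetric] A_def)
      finally show ?thesis .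
    qed (simp add: Y_def)
    have "emeasure lebesgue E \<le> emeasure lebesgue (\<Union>k. Y k)"
      using Y_sets by (intro emeasure_mono EY) auto
    also have "\<dots> \<le> (\<Sum>k. emeasure lebesgue (Y k))"
      using Y_sets by (rule emeasure_subadditive_countably)
    also have "\<dots> \<le> (\<Sum>k. ennreal (A / t) * emeasure \<nu> (X k))"
      by (intro suminf_le YX) auto
    also have "\<dots> = ennreal (A / t) * emeasure \<nu> (\<Union>k. X k)"
      using X_sets disj by (simp add: suminf_emeasure \<nu>_def)
    also have "\<dots> \<le> ennreal (A / t) * (\<integral>\<^sup>+x. ennreal \<bar>f x\<bar> \<partial>lebesgue)"
      using X_sets by (subst \<nu>) (auto intro!: mult_left_mono nn_integral_mono simp: indicator_def)
    finally show ?thesis by (simp add: E_def)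
  qed
  with A show ?thesis by blast
qed

lemma maximal_finite_AE:
  fixes f :: "real^'n \<Rightarrow> real"
  assumes "f \<in> borel_measurable lebesgue" "(\<integral>\<^sup>+x. ennreal \<bar>f x\<bar> \<partial>lebesgue) < \<infinity>"
  shows "AE x in lebesgue. maximal f x < \<infinity>"
proof -
  obtain A :: real where A: "0 < A" and
    weak: "\<forall>f\<in>borel_measurable lebesgue. \<forall>t>0.
      emeasure lebesgue {x::real^'n. ennreal t < maximal f x}
        \<le> ennreal (A / t) * (\<integral>\<^sup>+x. ennreal \<bar>f x\<bar> \<partial>lebesgue)"
    using maximal_weak_type by blast
  define i where "i = enn2real (\<integral>\<^sup>+x. ennreal \<bar>f x\<bar> \<partial>lebesgue)"
  have i: "(\<integral>\<^sup>+x. ennreal \<bar>f x\<bar> \<partial>lebesgue) = ennreal i" "0 \<le> i"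
    using assms(2) by (simp_all add: i_def)
  define N where "N = {x. maximal f x = \<infinity>}"
  have N: "N \<in> sets lebesgue"
    unfolding N_def by (simp add: borel_measurable_maximal_lebesgue)
  have "emeasure lebesgue N \<le> ennreal \<epsilon>" if "0 < \<epsilon>" for \<epsilon> :: real
  proof -
    \<comment> \<open>Chosen so that A i / t <= \<epsilon>; i + 1 in place of i keeps t positive
      when f vanishes almost everywhere.\<close>
    define t where "t = A * (i + 1) / \<epsilon>"
    have t: "0 < t" using A i that by (simp add: t_def)
    have "emeasure lebesgue N \<le> emeasure lebesgue {x. ennreal t < maximal f x}"
    proof (rule emeasure_mono)
      have "Measurable.pred lebesgue (\<lambda>x. ennreal t < maximal f x)" by measurable
      then show "{x. ennreal t < maximal f x} \<in> sets lebesgue" by (simp add: pred_def)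
    qed (auto simp: N_def)
    also have "\<dots> \<le> ennreal (A / t) * ennreal i"
      using weak assms(1) t i by fastforce
    also have "\<dots> = ennreal (A / t * i)"
      using A t i by (simp add: ennreal_mult[symmetric])
    also have "\<dots> \<le> ennreal \<epsilon>"
    proof (intro ennreal_leI)
      have "A / t * i = \<epsilon> * (i / (i + 1))" using A that by (simp add: t_def)
      also have "\<dots> \<le> \<epsilon>" using i that by (intro mult_left_le) auto
      finally show "A / t * i \<le> \<epsilon>" .
    qed
    finally show ?thesis .
  qed
  then have "emeasure lebesgue N = 0"
    by (metis ennreal_le_epsilon add_0 le_zero_eq)
  then show ?thesis
    using N by (intro AE_I[of _ _ N]) (auto simp: N_def less_top[symmetric])
qed

section \<open>The strong type (2,2) inequality for M\<close>

text \<open>The integral of 2t over [0, k] is k^2, and it is a lower bound for every real k <= u.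
  This also settles u = infinity: a finite value c of the integral would give (c + 1)^2 <=
  c.\<close>

lemma square_le_layer_cake:
  fixes u :: ennreal
  shows "u\<^sup>2 \<le> (\<integral>\<^sup>+t. ennreal (2 * t) * indicator {t. 0 < t \<and> ennreal t < u} t \<partial>lborel)" (is "_ \<le> ?I")
proof -
  have le: "(ennreal k)\<^sup>2 \<le> ?I" if k: "0 \<le> k" "ennreal k \<le> u" for k
  proof -
    have "(\<integral>\<^sup>+t. ennreal (2 * t) * indicator {0..k} t \<partial>lborel) = ennreal (k\<^sup>2 - 0\<^sup>2)"
      using k by (intro nn_integral_FTC_Icc[where F = "\<lambda>t. t\<^sup>2"]) (auto intro!: derivative_eq_intros)
    then have "(ennreal k)\<^sup>2 = (\<integral>\<^sup>+t. ennreal (2 * t) * indicator {0..k} t \<partial>lborel)"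
      using k by (simp add: ennreal_power)
    also have "\<dots> \<le> ?I"
    proof (rule nn_integral_mono_AE)
      have "AE t::real in lborel. t \<noteq> k" by (rule AE_lborel_singleton)
      then show "AE t in lborel. ennreal (2 * t) * indicator {0..k} t
          \<le> ennreal (2 * t) * indicator {t. 0 < t \<and> ennreal t < u} t"
      proof eventually_elim
        case (elim t)
        have "ennreal t < u" if "0 < t" "t < k"
          using that k by (metis ennreal_lessI order_less_le_trans order_less_trans)
        with elim show ?case by (auto simp: indicator_def)
      qed
    qed
    finally show ?thesis .
  qed
  show ?thesis
  proof (cases u)
    case (real r)
    with le[of r] show ?thesis by simp
  next
    case top
    have "?I = \<infinity>"
    proof (rule ccontr)
      assume "?I \<noteq> \<infinity>"
      then obtain c where c: "?I = ennreal c" "0 \<le> c" by (cases ?I) auto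
      have "ennreal ((c + 1)\<^sup>2) \<le> ennreal c"
        using le[of "c + 1"] top c by (simp add: ennreal_power del: ennreal_plus)
      then have "(c + 1)\<^sup>2 \<le> c" using c by (simp add: ennreal_le_iff)
      moreover have "c + 1 \<le> (c + 1)\<^sup>2" using c by (simp add: power2_eq_square)
      ultimately show False by simp
    qed
    then show ?thesis by simp
  qed
qed

text \<open>The discarded part of f is bounded by s, so it adds at most s to any average.\<close>

lemma maximal_le_truncation:
  fixes f :: "real^'n \<Rightarrow> real"
  assumes [measurable]: "f \<in> borel_measurable lebesgue" and "0 \<le> s"
  shows "maximal f x \<le> maximal (\<lambda>y. f y * indicator {y. s < \<bar>f y\<bar>} y) x + ennreal s"
  unfolding maximal_def[of f]
proof (rule SUP_least, clarify)
  fix Q :: "(real^'n) set" assume Q: "Q \<in> cubes" "x \<in> Q"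
  let ?g = "\<lambda>y. f y * indicator {y. s < \<bar>f y\<bar>} y"
  have [measurable]: "Q \<in> sets lebesgue" using Q by (simp add: sets_cube)
  have "(\<integral>\<^sup>+y\<in>Q. ennreal \<bar>f y\<bar> \<partial>lebesgue)
      \<le> (\<integral>\<^sup>+y. ennreal \<bar>?g y\<bar> * indicator Q y + ennreal s * indicator Q y \<partial>lebesgue)"
    using \<open>0 \<le> s\<close>
    by (intro nn_integral_mono)
      (auto simp: indicator_def not_less ennreal_leI ennreal_plus[symmetric] simp del: ennreal_plus)
  also have "\<dots> = (\<integral>\<^sup>+y\<in>Q. ennreal \<bar>?g y\<bar> \<partial>lebesgue) + ennreal s * emeasure lebesgue Q"
    by (subst nn_integral_add) (auto simp: nn_integral_cmult_indicator)
  finally have "average f Q \<le> ((\<integral>\<^sup>+y\<in>Q. ennreal \<bar>?g y\<bar> \<partial>lebesgue) + ennreal s * emeasure lebesgue Q)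
      / emeasure lebesgue Q"
    unfolding average_def by (rule divide_right_mono_ennreal)
  also have "\<dots> = average ?g Q + ennreal s"
    using emeasure_cube_neq[OF Q(1)]
    by (simp add: average_def add_divide_distrib_ennreal ennreal_mult_divide_eq)
  also have "\<dots> \<le> maximal ?g x + ennreal s"
    by (intro add_right_mono average_le_maximal Q)
  finally show "average f Q \<le> maximal ?g x + ennreal s" .
qed

text \<open>Marcinkiewicz interpolation: at level \<open>t\<close>
  only the part of \<open>f\<close> larger than \<open>t/2\<close> matters.\<close>

lemma maximal_square_bound:
  "\<exists>K>0. \<forall>f\<in>borel_measurable (lebesgue :: (real^'n) measure).
    (\<integral>\<^sup>+x. (maximal f x)\<^sup>2 \<partial>lebesgue) \<le> ennreal K * (\<integral>\<^sup>+x. ennreal ((f x)\<^sup>2) \<partial>lebesgue)"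
proof -
  obtain A :: real where A: "0 < A" and
    weak: "\<forall>f\<in>borel_measurable lebesgue. \<forall>t>0.
      emeasure lebesgue {x::real^'n. ennreal t < maximal f x}
        \<le> ennreal (A / t) * (\<integral>\<^sup>+x. ennreal \<bar>f x\<bar> \<partial>lebesgue)"
    using maximal_weak_type by blast
  interpret L: sigma_finite_measure "lebesgue :: (real^'n) measure"
    by (rule sigma_finite_lebesgue)
  interpret P: pair_sigma_finite "lborel :: real measure" "lebesgue :: (real^'n) measure" ..
  have "(\<integral>\<^sup>+x. (maximal f x)\<^sup>2 \<partial>lebesgue) \<le> ennreal (8 * A) * (\<integral>\<^sup>+x. ennreal ((f x)\<^sup>2) \<partial>lebesgue)"
    if [measurable]: "f \<in> borel_measurable lebesgue" for f :: "real^'n \<Rightarrow> real"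
  proof -
    note borel_measurable_maximal_lebesgue[measurable]
    have "(\<integral>\<^sup>+x. (maximal f x)\<^sup>2 \<partial>lebesgue)
        \<le> (\<integral>\<^sup>+x. (\<integral>\<^sup>+t. ennreal (2 * t) * indicator {t. 0 < t \<and> ennreal t < maximal f x} t \<partial>lborel) \<partial>lebesgue)"
      by (intro nn_integral_mono square_le_layer_cake)
    also have "\<dots> = (\<integral>\<^sup>+t. (\<integral>\<^sup>+x. ennreal (2 * t) * indicator {t. 0 < t \<and> ennreal t < maximal f x} t \<partial>lebesgue) \<partial>lborel)"
      by (rule P.Fubini') simp
    also have "\<dots> \<le> (\<integral>\<^sup>+t. (\<integral>\<^sup>+x. ennreal (4 * A) * ennreal \<bar>f x\<bar> * indicator {t. 0 < t \<and> t < 2 * \<bar>f x\<bar>} t \<partial>lebesgue) \<partial>lborel)"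
    proof (rule nn_integral_mono)
      fix t :: real
      show "(\<integral>\<^sup>+x. ennreal (2 * t) * indicator {t. 0 < t \<and> ennreal t < maximal f x} t \<partial>lebesgue)
        \<le> (\<integral>\<^sup>+x. ennreal (4 * A) * ennreal \<bar>f x\<bar> * indicator {t. 0 < t \<and> t < 2 * \<bar>f x\<bar>} t \<partial>lebesgue)"
      proof (cases "0 < t")
        case True
        let ?g = "\<lambda>y. f y * indicator {y. t / 2 < \<bar>f y\<bar>} y"
        have sub: "ennreal (t / 2) < maximal ?g x" if "ennreal t < maximal f x" for x
        proof (rule ccontr)
          assume "\<not> ennreal (t / 2) < maximal ?g x"
          then have "maximal ?g x + ennreal (t / 2) \<le> ennreal (t / 2) + ennreal (t / 2)"
            by (intro add_right_mono) simp
          moreover have "maximal f x \<le> maximal ?g x + ennreal (t / 2)"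
            using True by (intro maximal_le_truncation) auto
          ultimately have "maximal f x \<le> ennreal (t / 2) + ennreal (t / 2)"
            by (rule order_trans[rotated])
          also have "\<dots> = ennreal t" using True by (simp add: ennreal_plus[symmetric] del: ennreal_plus)
          finally show False using that by simp
        qed
        have [measurable]: "{x. ennreal t < maximal f x} \<in> sets lebesgue"
          "{x. ennreal (t/2) < maximal ?g x} \<in> sets lebesgue"
        proof -
          have "Measurable.pred lebesgue (\<lambda>x. ennreal t < maximal f x)"
            "Measurable.pred lebesgue (\<lambda>x. ennreal (t/2) < maximal ?g x)" by measurable
          then show "{x. ennreal t < maximal f x} \<in> sets lebesgue"
            "{x. ennreal (t/2) < maximal ?g x} \<in> sets lebesgue" by (simp_all add: pred_def)
        qed
        have "(\<integral>\<^sup>+x. ennreal (2 * t) * indicator {t. 0 < t \<and> ennreal t < maximal f x} t \<partial>lebesgue)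
            = (\<integral>\<^sup>+x. ennreal (2 * t) * indicator {x. ennreal t < maximal f x} x \<partial>lebesgue)"
          using True by (intro nn_integral_cong) (auto simp: indicator_def)
        also have "\<dots> = ennreal (2 * t) * emeasure lebesgue {x. ennreal t < maximal f x}"
          by (simp add: nn_integral_cmult_indicator)
        also have "\<dots> \<le> ennreal (2 * t) * emeasure lebesgue {x. ennreal (t/2) < maximal ?g x}"
          using sub by (intro mult_left_mono emeasure_mono) auto
        also have "\<dots> \<le> ennreal (2 * t) * (ennreal (A / (t / 2)) * (\<integral>\<^sup>+x. ennreal \<bar>?g x\<bar> \<partial>lebesgue))"
        proof (intro mult_left_mono)
          have "?g \<in> borel_measurable lebesgue" by measurable
          then show "emeasure lebesgue {x. ennreal (t/2) < maximal ?g x} \<le>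
              ennreal (A / (t / 2)) * (\<integral>\<^sup>+x. ennreal \<bar>?g x\<bar> \<partial>lebesgue)"
            using True by (intro weak[rule_format]) auto
        qed simp
        \<comment> \<open>The factor 2t of the layer cake formula cancels the 1/t of the weak type
          bound, so t survives only in the truncation. Integrating over t < 2|f| then yields
          |f|^2.\<close>
        also have "\<dots> = ennreal (4 * A) * (\<integral>\<^sup>+x. ennreal \<bar>?g x\<bar> \<partial>lebesgue)"
        proof -
          have "ennreal (2 * t) * ennreal (A / (t / 2)) = ennreal (4 * A)"
            using True A by (subst ennreal_mult[symmetric]) auto
          then show ?thesis by (simp only: mult.assoc[symmetric])
        qed
        also have "\<dots> = (\<integral>\<^sup>+x. ennreal (4 * A) * ennreal \<bar>?g x\<bar> \<partial>lebesgue)"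
          by (rule nn_integral_cmult[symmetric]) simp
        also have "\<dots> = (\<integral>\<^sup>+x. ennreal (4 * A) * ennreal \<bar>f x\<bar> * indicator {t. 0 < t \<and> t < 2 * \<bar>f x\<bar>} t \<partial>lebesgue)"
          using True by (intro nn_integral_cong) (auto simp: indicator_def)
        finally show ?thesis .
      qed simp
    qed
    also have "\<dots> = (\<integral>\<^sup>+x. (\<integral>\<^sup>+t. ennreal (4 * A) * ennreal \<bar>f x\<bar> * indicator {t. 0 < t \<and> t < 2 * \<bar>f x\<bar>} t \<partial>lborel) \<partial>lebesgue)"
      by (rule P.Fubini'[symmetric]) simp
    also have "\<dots> = (\<integral>\<^sup>+x. ennreal (8 * A) * ennreal ((f x)\<^sup>2) \<partial>lebesgue)"
    proof (rule nn_integral_cong)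
      fix x
      have eq: "{t. 0 < t \<and> t < 2 * \<bar>f x\<bar>} = {0<..<2 * \<bar>f x\<bar>}" by auto
      have "(\<integral>\<^sup>+t. ennreal (4 * A) * ennreal \<bar>f x\<bar> * indicator {t. 0 < t \<and> t < 2 * \<bar>f x\<bar>} t \<partial>lborel)
          = ennreal (4 * A) * ennreal \<bar>f x\<bar> * ennreal (2 * \<bar>f x\<bar>)"
        unfolding eq by (simp add: nn_integral_cmult_indicator)
      also have "\<dots> = ennreal (8 * A) * ennreal ((f x)\<^sup>2)"
        using A by (simp add: ennreal_mult[symmetric] power2_eq_square)
      finally show "(\<integral>\<^sup>+t. ennreal (4 * A) * ennreal \<bar>f x\<bar> * indicator {t. 0 < t \<and> t < 2 * \<bar>f x\<bar>} t \<partial>lborel)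
        = ennreal (8 * A) * ennreal ((f x)\<^sup>2)" .
    qed
    also have "\<dots> = ennreal (8 * A) * (\<integral>\<^sup>+x. ennreal ((f x)\<^sup>2) \<partial>lebesgue)"
      by (rule nn_integral_cmult) simp
    finally show ?thesis .
  qed
  with A show ?thesis by (intro exI[of _ "8 * A"]) auto
qed

section \<open>An admissible pair of constant exponents\<close>

lemma const_in_exponents: "1 < c \<Longrightarrow> (\<lambda>x::real^'n. c) \<in> exponents"
  unfolding exponents_def exponent_inf_def exponent_sup_def
proof (intro CollectI conjI allI)
  assume c: "1 < c"
  have "ereal c \<le> Sup {z. AE x::real^'n in lebesgue. z \<le> ereal c}"
    by (intro Sup_upper) auto
  moreover have "1 < ereal c" using c by (simp add: one_ereal_def)
  ultimately show "1 < Sup {z. AE x::real^'n in lebesgue. z \<le> ereal c}"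
    by (rule order.strict_trans2[rotated])
  show "esssup lebesgue (\<lambda>x::real^'n. ereal c) < \<infinity>"
    by (subst esssup_const) auto
qed auto

lemma modular_two: "modular (\<lambda>_. 2) f = (\<integral>\<^sup>+x. ennreal ((f x)\<^sup>2) \<partial>lebesgue)"
  unfolding modular_def by (intro nn_integral_cong) (auto simp: powr_numeral)

text \<open>For the constant exponent 2 the modular is the integral of the square and scales by r^2,
  so the constant K of \<open>maximal_square_bound\<close> turns into sqrt K for norms.\<close>

lemma two_in_maximal_exponents: "(\<lambda>x::real^'n. 2) \<in> maximal_exponents"
proof -
  obtain K :: real where K: "0 < K" and bound: "\<forall>f\<in>borel_measurable (lebesgue :: (real^'n) measure).
      (\<integral>\<^sup>+x. (maximal f x)\<^sup>2 \<partial>lebesgue) \<le> ennreal K * (\<integral>\<^sup>+x. ennreal ((f x)\<^sup>2) \<partial>lebesgue)"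
    using maximal_square_bound by blast
  have scale: "(\<integral>\<^sup>+x. ennreal ((f x)\<^sup>2) \<partial>lebesgue) = ennreal (r\<^sup>2) * modular (\<lambda>_. 2) (\<lambda>x. f x / r)"
    if [measurable]: "f \<in> borel_measurable lebesgue" and r: "0 < r" for f :: "real^'n \<Rightarrow> real" and r
  proof -
    have "(\<integral>\<^sup>+x. ennreal ((f x)\<^sup>2) \<partial>lebesgue) = (\<integral>\<^sup>+x. ennreal (r\<^sup>2) * ennreal ((f x / r)\<^sup>2) \<partial>lebesgue)"
      using r by (intro nn_integral_cong) (simp add: ennreal_mult[symmetric] power_divide)
    then show ?thesis by (simp add: modular_two nn_integral_cmult)
  qed
  have "bounded_operator (\<lambda>f (x::real^'n). enn2ereal (maximal f x)) (\<lambda>_. 2) (\<lambda>_. 2)"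
    unfolding bounded_operator_def
  proof (intro exI[of _ "sqrt K"] ballI conjI)
    fix f :: "real^'n \<Rightarrow> real" assume f: "f \<in> Lvar (\<lambda>_. 2)"
    then have [measurable]: "f \<in> borel_measurable lebesgue" by (simp add: Lvar_def)
    note borel_measurable_maximal_lebesgue[measurable]
    from f obtain r where r: "0 < r" "modular (\<lambda>_. 2) (\<lambda>x. f x / r) \<le> 1"
      by (rule Lvar_modular_le_1[rotated 2]) auto
    have "(\<integral>\<^sup>+x. (maximal f x)\<^sup>2 \<partial>lebesgue) \<le> ennreal K * (\<integral>\<^sup>+x. ennreal ((f x)\<^sup>2) \<partial>lebesgue)"
      using bound by simp
    also have "\<dots> \<le> ennreal K * (ennreal (r\<^sup>2) * 1)"
      unfolding scale[OF \<open>f \<in> borel_measurable lebesgue\<close> r(1)] by (intro mult_left_mono r) auto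
    also have "\<dots> < \<infinity>" by (simp add: ennreal_mult_less_top)
    finally have "AE x in lebesgue. (maximal f x)\<^sup>2 \<noteq> \<infinity>"
      by (intro nn_integral_PInf_AE) auto
    then have fin: "AE x in lebesgue. maximal f x \<noteq> \<infinity>"
      by eventually_elim (auto simp: power2_eq_square)
    then show "AE x in lebesgue. \<bar>enn2ereal (maximal f x)\<bar> \<noteq> \<infinity>"
      by eventually_elim (auto simp: enn2ereal_eq_top_iff)
    let ?m = "\<lambda>x. real_of_ereal (enn2ereal (maximal f x))"
    have m: "AE x in lebesgue. ennreal ((?m x)\<^sup>2) = (maximal f x)\<^sup>2"
      using fin
    proof eventually_elim
      case (elim x)
      then show ?case
        by (cases "maximal f x") (auto simp: ennreal_power)
    qed
    show "Lvar_norm (\<lambda>_. 2) ?m \<le> ennreal (sqrt K) * Lvar_norm (\<lambda>_. 2) f"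
    proof (rule Lvar_norm_le_mult)
      fix r assume r: "0 < r" "modular (\<lambda>_. 2) (\<lambda>x. f x / r) \<le> 1"
      have "ennreal ((sqrt K * r)\<^sup>2) * modular (\<lambda>_. 2) (\<lambda>x. ?m x / (sqrt K * r))
          = (\<integral>\<^sup>+x. ennreal ((?m x)\<^sup>2) \<partial>lebesgue)"
        using r K by (intro scale[symmetric]) auto
      also have "\<dots> = (\<integral>\<^sup>+x. (maximal f x)\<^sup>2 \<partial>lebesgue)"
        by (rule nn_integral_cong_AE[OF m])
      also have "\<dots> \<le> ennreal K * (\<integral>\<^sup>+x. ennreal ((f x)\<^sup>2) \<partial>lebesgue)"
        using bound by simp
      also have "\<dots> \<le> ennreal K * (ennreal (r\<^sup>2) * 1)"
        unfolding scale[OF \<open>f \<in> borel_measurable lebesgue\<close> r(1)] by (intro mult_left_mono r) auto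
      also have "\<dots> = ennreal ((sqrt K * r)\<^sup>2) * 1"
        using K by (simp add: ennreal_mult[symmetric] power_mult_distrib)
      finally show "modular (\<lambda>_. 2) (\<lambda>x. ?m x / (sqrt K * r)) \<le> 1"
        using r K by (subst (asm) ennreal_mult_le_mult_iff) (auto simp del: ennreal_plus)
    qed (use K f in auto)
  qed
  then show ?thesis
    unfolding maximal_exponents_def by (simp add: const_in_exponents)
qed

lemma exponent_pairs_nonempty:
  assumes "0 < \<beta>" "\<beta> < 1"
  shows "exponent_pairs \<beta> \<noteq> ({} :: ((real^'n \<Rightarrow> real) \<times> (real^'n \<Rightarrow> real)) set)"
proof -
  define n where "n = real CARD('n)"
  have n: "1 \<le> n" by (simp add: n_def Suc_le_eq)
  \<comment> \<open>Solving q (n - \<beta>) / n = 2 gives q, and 1/p = 1/q + \<beta>/n gives p. The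
    requirement \<beta> < n/p becomes \<beta> < n.\<close>
  define p where "p = 2 * n / (n + \<beta>)"
  define q where "q = 2 * n / (n - \<beta>)"
  have p: "1 < p" using assms n by (simp add: p_def field_simps)
  have sup: "exponent_sup (\<lambda>x::real^'n. p) = ereal p"
    unfolding exponent_sup_def by (rule esssup_const) simp
  have "\<beta> * (2 * n) < n * (n + \<beta>)"
    using assms n by (simp add: algebra_simps)
  then have "\<beta> < n / p"
    using assms n by (simp add: p_def field_simps)
  then have lt: "ereal \<beta> < ereal n / exponent_sup (\<lambda>x::real^'n. p)"
    using p by (simp add: sup)
  have "1 / q = 1 / p - \<beta> / n"
    using assms n by (simp add: p_def q_def field_simps)
  moreover have "q * (n - \<beta>) / n = 2"
    using assms n by (simp add: q_def)
  ultimately have "((\<lambda>x::real^'n. p), (\<lambda>x::real^'n. q)) \<in> exponent_pairs \<beta>"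
    using lt p assms unfolding exponent_pairs_def
    by (simp add: n_def[symmetric] const_in_exponents two_in_maximal_exponents)
  then show ?thesis by blast
qed

section \<open>Lipschitz functions have bounded commutators\<close>

lemma maximal_exponentsD:
  assumes "s \<in> maximal_exponents"
  shows "s \<in> borel_measurable lebesgue" "1 \<le> s x"
    "bounded_operator (\<lambda>f x. enn2ereal (maximal f x)) s s"
  using assms by (auto simp: maximal_exponents_def exponents_def)

text \<open>\<open>exponent_pairs\<close> constrains q only through its relation to p and through s
  = q (1 - \<theta>). Measurability of q and q >= 1 are recovered from those of s, using 0 < 1 -
  \<theta> < 1.\<close>

lemma exponent_pairsD:
  fixes p q :: "real^'n \<Rightarrow> real" and \<beta> :: real
  assumes pq: "(p, q) \<in> exponent_pairs \<beta>" and "\<beta> < 1" and \<theta>: "\<theta> = \<beta> / real CARD('n)"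
  shows "0 < \<theta>" "\<theta> < 1" "p \<in> borel_measurable lebesgue" "q \<in> borel_measurable lebesgue"
    "1 \<le> p x" "1 \<le> q x" "(\<lambda>x. q x * (1 - \<theta>)) \<in> maximal_exponents"
    "AE x in lebesgue. 1 / q x = 1 / p x - \<theta>"
proof -
  define n where "n = real CARD('n)"
  have n: "1 \<le> n" by (simp add: n_def Suc_le_eq)
  show 0: "0 < \<theta>" using pq n by (auto simp: exponent_pairs_def \<theta> n_def)
  show 1: "\<theta> < 1" using \<open>\<beta> < 1\<close> n unfolding \<theta> n_def[symmetric] by simp
  show "p \<in> borel_measurable lebesgue" "1 \<le> p x" "AE x in lebesgue. 1 / q x = 1 / p x - \<theta>"
    using pq by (auto simp: exponent_pairs_def exponents_def \<theta>)
  have "q x * (n - \<beta>) / n = q x * (1 - \<theta>)" for x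
    using n unfolding \<theta> n_def[symmetric] by (simp add: field_simps)
  then show s: "(\<lambda>x. q x * (1 - \<theta>)) \<in> maximal_exponents"
    using pq by (auto simp: exponent_pairs_def n_def)
  from s have "(\<lambda>x. q x * (1 - \<theta>)) \<in> borel_measurable lebesgue"
    by (rule maximal_exponentsD)
  then have "(\<lambda>x. q x * (1 - \<theta>) * inverse (1 - \<theta>)) \<in> borel_measurable lebesgue"
    by (rule borel_measurable_times) simp
  moreover have "(\<lambda>x. q x * (1 - \<theta>) * inverse (1 - \<theta>)) = q" using 1 by auto
  ultimately show "q \<in> borel_measurable lebesgue" by simp
  have s1: "1 \<le> q x * (1 - \<theta>)" using s by (rule maximal_exponentsD)
  then have "0 < q x * (1 - \<theta>)" by simp
  with 1 have "0 < q x" by (simp add: zero_less_mult_iff)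
  then have "q x * (1 - \<theta>) \<le> q x * 1" using 0 by (intro mult_left_mono) auto
  with s1 show "1 \<le> q x" by simp
qed

text \<open>The Hedberg step. Since p/q + p \<theta> = 1, the function |f/r| factors as A^(1 -
  \<theta>) B^\<theta>, where A is |f/r|^(p/s) with s = q (1 - \<theta>) and B = |f/r|^p has
  integral at most 1. Hoelder's inequality over Q then leaves only the average of A and a power of
  |Q|.\<close>

lemma fractional_average_bound:
  fixes f p q :: "real^'n \<Rightarrow> real"
  assumes [measurable]: "f \<in> borel_measurable lebesgue" "p \<in> borel_measurable lebesgue"
      "q \<in> borel_measurable lebesgue"
    and \<theta>: "0 < \<theta>" "\<theta> < 1"
    and pos: "\<And>x. 0 < p x" "\<And>x. 0 < q x"
    and pq: "AE x in lebesgue. 1 / q x = 1 / p x - \<theta>"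
    and r: "0 < r" "modular p (\<lambda>x. f x / r) \<le> 1"
    and Q: "Q \<in> cubes" and m: "0 \<le> m"
    and h: "average (\<lambda>x. \<bar>f x / r\<bar> powr (p x / (q x * (1 - \<theta>)))) Q \<le> ennreal m"
  shows "average f Q \<le> ennreal (r * m powr (1 - \<theta>) * measure lebesgue Q powr - \<theta>)"
proof -
  define \<mu> where "\<mu> = measure lebesgue Q"
  have \<mu>: "0 < \<mu>" using measure_cube_pos[OF Q] by (simp add: \<mu>_def)
  have [measurable]: "Q \<in> sets lebesgue" using Q by (rule sets_cube)
  define A where "A x = \<bar>f x / r\<bar> powr (p x / (q x * (1 - \<theta>))) * indicator Q x" for x
  define B where "B x = \<bar>f x / r\<bar> powr p x" for x
  have [measurable]: "A \<in> borel_measurable lebesgue" "B \<in> borel_measurable lebesgue"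
    unfolding A_def B_def by measurable
  have "(\<integral>\<^sup>+x. ennreal (A x) \<partial>lebesgue) =
      (\<integral>\<^sup>+x\<in>Q. ennreal \<bar>\<bar>f x / r\<bar> powr (p x / (q x * (1 - \<theta>)))\<bar> \<partial>lebesgue)"
    by (intro nn_integral_cong) (auto simp: A_def indicator_def)
  also have "\<dots> \<le> ennreal (m * \<mu>)"
    using h unfolding average_le_iff[OF Q m] \<mu>_def .
  finally have A: "(\<integral>\<^sup>+x. ennreal (A x) \<partial>lebesgue) \<le> ennreal (m * \<mu>)" .
  have B: "(\<integral>\<^sup>+x. ennreal (B x) \<partial>lebesgue) \<le> ennreal 1"
    using r by (simp add: modular_def B_def)
  have "(\<integral>\<^sup>+x\<in>Q. ennreal \<bar>f x\<bar> \<partial>lebesgue)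
      = (\<integral>\<^sup>+x. ennreal r * ennreal (A x powr (1 - \<theta>) * B x powr \<theta>) \<partial>lebesgue)"
  proof (rule nn_integral_cong_AE)
    show "AE x in lebesgue. ennreal \<bar>f x\<bar> * indicator Q x =
        ennreal r * ennreal (A x powr (1 - \<theta>) * B x powr \<theta>)"
      using pq
    proof eventually_elim
      case (elim x)
      have "p x / q x + p x * \<theta> = p x * (1 / q x + \<theta>)" by (simp add: algebra_simps)
      also have "\<dots> = 1" using pos(1)[of x] elim by simp
      finally have exps: "p x / q x + p x * \<theta> = 1" .
      show ?case
      proof (cases "x \<in> Q")
        case True
        have "A x powr (1 - \<theta>) * B x powr \<theta> = \<bar>f x / r\<bar> powr (p x / q x) * \<bar>f x / r\<bar> powr (p x * \<theta>)"
          using True \<theta> by (simp add: A_def B_def powr_powr)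
        also have "\<dots> = \<bar>f x / r\<bar>"
          by (simp add: powr_add[symmetric] exps)
        finally show ?thesis
          using True r by (simp add: ennreal_mult[symmetric])
      qed (simp add: A_def)
    qed
  qed
  also have "\<dots> = ennreal r * (\<integral>\<^sup>+x. ennreal (A x powr (1 - \<theta>) * B x powr \<theta>) \<partial>lebesgue)"
    by (rule nn_integral_cmult) simp
  also have "\<dots> \<le> ennreal r * ennreal ((m * \<mu>) powr (1 - \<theta>) * 1 powr \<theta>)"
    using m \<mu> \<theta> A B
    by (intro mult_left_mono nn_integral_Holder_bound) (auto simp: A_def B_def)
  also have "\<dots> = ennreal (r * m powr (1 - \<theta>) * \<mu> powr - \<theta> * \<mu>)"
    using r m \<mu> by (simp add: ennreal_mult[symmetric] powr_mult powr_diff powr_minus_divide)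
  finally show ?thesis
    using r Q by (subst average_le_iff) (auto simp: \<mu>_def)
qed

text \<open>Cubes of measure below 1 through x stay in a fixed ball, where f is integrable and the
  weak type inequality applies; the others are controlled by D. The quantifier over D stands inside
  the almost-everywhere statement because D will depend on x.\<close>

lemma maximal_finite_if_large_averages_bounded:
  fixes f :: "real^'n \<Rightarrow> real"
  assumes [measurable]: "f \<in> borel_measurable lebesgue"
    and f: "\<And>N::nat. (\<integral>\<^sup>+x\<in>cball 0 N. ennreal \<bar>f x\<bar> \<partial>lebesgue) < \<infinity>"
  shows "AE x in lebesgue. \<forall>D::real. (\<forall>Q\<in>cubes. x \<in> Q \<longrightarrow> 1 \<le> measure lebesgue Q \<longrightarrow>
    average f Q \<le> ennreal D) \<longrightarrow> maximal f x < \<infinity>"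
proof -
  let ?g = "\<lambda>N x. f x * indicator (cball 0 (real N)) x"
  have "AE x in lebesgue. \<forall>N. maximal (?g N) x < \<infinity>"
    unfolding AE_all_countable
  proof
    fix N
    have "(\<integral>\<^sup>+x. ennreal \<bar>?g N x\<bar> \<partial>lebesgue) = (\<integral>\<^sup>+x\<in>cball 0 N. ennreal \<bar>f x\<bar> \<partial>lebesgue)"
      by (intro nn_integral_cong) (auto simp: indicator_def)
    moreover have "?g N \<in> borel_measurable lebesgue"
      by (intro borel_measurable_times borel_measurable_indicator) auto
    ultimately show "AE x in lebesgue. maximal (?g N) x < \<infinity>"
      using f by (intro maximal_finite_AE) auto
  qed
  then show ?thesis
  proof eventually_elim
    case (elim x)
    show ?case
    proof (intro allI impI)
      fix D :: real
      assume D: "\<forall>Q\<in>cubes. x \<in> Q \<longrightarrow> 1 \<le> measure lebesgue Q \<longrightarrow> average f Q \<le> ennreal D"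
      obtain N :: nat where N: "norm x + CARD('n) \<le> N" using real_arch_simple by blast
      have "maximal f x \<le> max (maximal (?g N) x) (ennreal D)"
        unfolding maximal_def[of f]
      proof (rule SUP_least, clarify)
        fix Q :: "(real^'n) set" assume Q: "Q \<in> cubes" "x \<in> Q"
        show "average f Q \<le> max (maximal (?g N) x) (ennreal D)"
        proof (cases "1 \<le> measure lebesgue Q")
          case True
          with Q D show ?thesis by (auto intro: max.coboundedI2)
        next
          case False
          from Q(1) obtain a l where l: "Q = box a (a + vec l)" "0 < l" by (rule cubesE)
          with False have "l ^ CARD('n) < 1" by (metis less_imp_le measure_box_vec not_less)
          with l have "l < 1" by (meson less_imp_le not_le one_le_power)
          have "Q \<subseteq> cball 0 N"
          proof
            fix y assume "y \<in> Q"
            then have "norm (y - x) \<le> CARD('n) * l" using Q l by (auto intro: norm_diff_box_vec)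
            also have "\<dots> \<le> CARD('n)" using \<open>l < 1\<close> by simp
            finally show "y \<in> cball 0 N"
              using N norm_triangle_ineq[of x "y - x"] by simp
          qed
          then have "average f Q = average (?g N) Q"
            by (intro average_cong) auto
          also have "\<dots> \<le> maximal (?g N) x" by (rule average_le_maximal) fact+
          finally show ?thesis by (rule max.coboundedI1)
        qed
      qed
      also have "\<dots> < \<infinity>" using elim by auto
      finally show "maximal f x < \<infinity>" .
    qed
  qed
qed

text \<open>On a cube of side l through x, b deviates from b(x) by at most L (n l)^\<beta>, so the
  averages of |b f| and of b(x) |f| differ by at most this times the average of |f|. The decay
  assumed in \<open>avg\<close> cancels l^\<beta>, and both one-sided estimates pass to the
  supremum.\<close>

lemma commutator_pointwise_bound:
  fixes f b :: "real^'n \<Rightarrow> real"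
  assumes [measurable]: "f \<in> borel_measurable lebesgue" "b \<in> borel_measurable lebesgue"
    and \<beta>: "0 < \<beta>" and bx: "0 \<le> b x" and L: "0 \<le> L" and D: "0 \<le> D"
    and lip: "AE y in lebesgue. \<bar>b y - b x\<bar> \<le> L * norm (y - x) powr \<beta>"
    and avg: "\<And>Q. Q \<in> cubes \<Longrightarrow> x \<in> Q \<Longrightarrow>
      average f Q \<le> ennreal (D * measure lebesgue Q powr - (\<beta> / CARD('n)))"
    and fin: "maximal f x < \<infinity>"
  shows "\<bar>commutator b f x\<bar> \<noteq> \<infinity>"
    "\<bar>real_of_ereal (commutator b f x)\<bar> \<le> L * real CARD('n) powr \<beta> * D"
proof -
  define n where "n = CARD('n)"
  have n: "0 < n" by (simp add: n_def)
  define K where "K = L * real n powr \<beta> * D"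
  have K: "0 \<le> K" using L D by (simp add: K_def)
  let ?bf = "\<lambda>y. b y * f y"
  have both: "average ?bf Q \<le> ennreal (b x) * average f Q + ennreal K \<and>
      ennreal (b x) * average f Q \<le> average ?bf Q + ennreal K"
    if Q: "Q \<in> cubes" "x \<in> Q" for Q
  proof -
    from Q(1) obtain a l where l: "Q = box a (a + vec l)" "0 < l" by (rule cubesE)
    have [measurable]: "Q \<in> sets lebesgue" using Q by (simp add: sets_cube)
    have mQ: "measure lebesgue Q = l ^ n" unfolding l(1) n_def using l by (intro measure_box_vec) auto
    define c where "c = L * real n powr \<beta> * l powr \<beta>"
    have c: "0 \<le> c" using L by (simp add: c_def)
    have diff: "AE y in lebesgue. y \<in> Q \<longrightarrow> \<bar>b y - b x\<bar> \<le> c"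
      using lip
    proof eventually_elim
      case (elim y)
      show ?case
      proof
        assume "y \<in> Q"
        then have "norm (y - x) \<le> n * l" using Q l by (auto intro: norm_diff_box_vec simp: n_def)
        then have "norm (y - x) powr \<beta> \<le> (n * l) powr \<beta>" using \<beta> by (intro powr_mono2) auto
        then have "L * norm (y - x) powr \<beta> \<le> c"
          using L l by (auto simp: c_def powr_mult mult.assoc intro!: mult_left_mono)
        with elim show "\<bar>b y - b x\<bar> \<le> c" by simp
      qed
    qed
    \<comment> \<open>Here the side length drops out: the error \<open>K\<close> is the same for all
      cubes through x.\<close>
    have "(l ^ n) powr - (\<beta> / n) = l powr - \<beta>"
      using l n by (simp add: powr_realpow[symmetric] powr_powr)
    then have "ennreal c * average f Q \<le> ennreal c * ennreal (D * l powr - \<beta>)"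
      using avg[OF Q] by (intro mult_left_mono) (auto simp: mQ n_def)
    also have "\<dots> = ennreal K"
      using c D l by (simp add: ennreal_mult[symmetric] c_def K_def powr_minus field_simps)
    finally have cK: "ennreal c * average f Q \<le> ennreal K" .
    have lin: "ennreal u * (\<integral>\<^sup>+y\<in>Q. ennreal \<bar>g y\<bar> \<partial>lebesgue) / emeasure lebesgue Q = ennreal u * average g Q"
      for u g unfolding average_def by (rule ennreal_times_divide[symmetric])
    have "(\<integral>\<^sup>+y\<in>Q. ennreal \<bar>?bf y\<bar> \<partial>lebesgue) \<le>
        (\<integral>\<^sup>+y. ennreal (b x) * (ennreal \<bar>f y\<bar> * indicator Q y) + ennreal c * (ennreal \<bar>f y\<bar> * indicator Q y) \<partial>lebesgue)"
    proof (rule nn_integral_mono_AE)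
      show "AE y in lebesgue. ennreal \<bar>?bf y\<bar> * indicator Q y \<le>
          ennreal (b x) * (ennreal \<bar>f y\<bar> * indicator Q y) + ennreal c * (ennreal \<bar>f y\<bar> * indicator Q y)"
        using diff
      proof eventually_elim
        case (elim y)
        show ?case
        proof (cases "y \<in> Q")
          case True
          with elim have "\<bar>b y\<bar> \<le> b x + c" using bx by auto
          then have "\<bar>?bf y\<bar> \<le> b x * \<bar>f y\<bar> + c * \<bar>f y\<bar>"
            by (simp add: abs_mult distrib_right[symmetric] mult_right_mono)
          with True bx c show ?thesis
            by (simp add: ennreal_mult[symmetric] ennreal_plus[symmetric] ennreal_leI del: ennreal_plus)
        qed simp
      qed
    qed
    also have "\<dots> = ennreal (b x) * (\<integral>\<^sup>+y\<in>Q. ennreal \<bar>f y\<bar> \<partial>lebesgue) + ennreal c * (\<integral>\<^sup>+y\<in>Q. ennreal \<bar>f y\<bar> \<partial>lebesgue)"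
      by (simp add: nn_integral_add nn_integral_cmult)
    finally have "average ?bf Q \<le> ennreal (b x) * average f Q + ennreal c * average f Q"
      unfolding lin[symmetric] add_divide_distrib_ennreal[symmetric] average_def[of ?bf]
      by (rule divide_right_mono_ennreal)
    then have 1: "average ?bf Q \<le> ennreal (b x) * average f Q + ennreal K"
      using cK by (meson add_left_mono order_trans)
    have "ennreal (b x) * (\<integral>\<^sup>+y\<in>Q. ennreal \<bar>f y\<bar> \<partial>lebesgue)
        = (\<integral>\<^sup>+y. ennreal (b x) * (ennreal \<bar>f y\<bar> * indicator Q y) \<partial>lebesgue)"
      by (simp add: nn_integral_cmult)
    also have "\<dots> \<le> (\<integral>\<^sup>+y. ennreal \<bar>?bf y\<bar> * indicator Q y + ennreal c * (ennreal \<bar>f y\<bar> * indicator Q y) \<partial>lebesgue)"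
    proof (rule nn_integral_mono_AE)
      show "AE y in lebesgue. ennreal (b x) * (ennreal \<bar>f y\<bar> * indicator Q y) \<le>
          ennreal \<bar>?bf y\<bar> * indicator Q y + ennreal c * (ennreal \<bar>f y\<bar> * indicator Q y)"
        using diff
      proof eventually_elim
        case (elim y)
        show ?case
        proof (cases "y \<in> Q")
          case True
          with elim have "b x \<le> \<bar>b y\<bar> + c" using bx by auto
          then have "b x * \<bar>f y\<bar> \<le> \<bar>?bf y\<bar> + c * \<bar>f y\<bar>"
            by (simp add: abs_mult distrib_right[symmetric] mult_right_mono)
          with True bx c show ?thesis
            by (simp add: ennreal_mult[symmetric] ennreal_plus[symmetric] ennreal_leI del: ennreal_plus)
        qed simp
      qed
    qed
    also have "\<dots> = (\<integral>\<^sup>+y\<in>Q. ennreal \<bar>?bf y\<bar> \<partial>lebesgue) + ennreal c * (\<integral>\<^sup>+y\<in>Q. ennreal \<bar>f y\<bar> \<partial>lebesgue)"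
      by (simp add: nn_integral_add nn_integral_cmult)
    finally have "ennreal (b x) * average f Q \<le> average ?bf Q + ennreal c * average f Q"
      unfolding lin[symmetric] add_divide_distrib_ennreal[symmetric] average_def[of ?bf]
      by (rule divide_right_mono_ennreal)
    then have "ennreal (b x) * average f Q \<le> average ?bf Q + ennreal K"
      using cK by (meson add_left_mono order_trans)
    with 1 show ?thesis by simp
  qed
  have up: "maximal ?bf x \<le> ennreal (b x) * maximal f x + ennreal K"
    unfolding maximal_def[of ?bf]
  proof (rule SUP_least, clarify)
    fix Q :: "(real^'n) set" assume Q: "Q \<in> cubes" "x \<in> Q"
    have "ennreal (b x) * average f Q + ennreal K \<le> ennreal (b x) * maximal f x + ennreal K"
      by (intro add_right_mono mult_left_mono average_le_maximal Q) auto
    with both[OF Q] show "average ?bf Q \<le> ennreal (b x) * maximal f x + ennreal K"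
      by (meson order_trans)
  qed
  have "{Q \<in> cubes. x \<in> Q} \<noteq> {}" using cube_around[of 1 x] by auto
  then have "ennreal (b x) * maximal f x = (SUP Q\<in>{Q \<in> cubes. x \<in> Q}. ennreal (b x) * average f Q)"
    unfolding maximal_def by (simp add: SUP_mult_left_ennreal)
  also have "\<dots> \<le> maximal ?bf x + ennreal K"
  proof (rule SUP_least, clarify)
    fix Q :: "(real^'n) set" assume Q: "Q \<in> cubes" "x \<in> Q"
    have "average ?bf Q + ennreal K \<le> maximal ?bf x + ennreal K"
      by (intro add_right_mono average_le_maximal Q)
    with both[OF Q] show "ennreal (b x) * average f Q \<le> maximal ?bf x + ennreal K"
      by (meson order_trans)
  qed
  finally have low: "ennreal (b x) * maximal f x \<le> maximal ?bf x + ennreal K" .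
  obtain m where m: "maximal f x = ennreal m" "0 \<le> m" using fin by (cases "maximal f x") auto
  have up': "maximal ?bf x \<le> ennreal (b x * m + K)"
    using up m bx K by (simp add: ennreal_mult)
  then obtain m' where m': "maximal ?bf x = ennreal m'" "0 \<le> m'"
    by (cases "maximal ?bf x") (auto simp: top_unique)
  have 1: "m' \<le> b x * m + K"
    using up' m m' bx K by (simp add: ennreal_le_iff del: ennreal_plus)
  have "ennreal (b x * m) \<le> ennreal (m' + K)"
    using low m m' bx K by (simp add: ennreal_mult)
  then have 2: "b x * m \<le> m' + K"
    using m' K by (simp add: ennreal_le_iff del: ennreal_plus)
  have comm: "commutator b f x = ereal (b x * m - m')"
    using m m' by (simp add: commutator_def enn2ereal_ennreal)
  then show "\<bar>commutator b f x\<bar> \<noteq> \<infinity>" by simp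
  show "\<bar>real_of_ereal (commutator b f x)\<bar> \<le> L * real CARD('n) powr \<beta> * D"
    using 1 2 by (simp add: comm K_def n_def abs_le_iff)
qed

lemma locally_integrable_measurable:
  fixes b :: "real^'n \<Rightarrow> real"
  assumes "locally_integrable b"
  shows "b \<in> borel_measurable lebesgue"
proof -
  have "(\<lambda>x. indicator (cball 0 (real N)) x * b x) \<in> borel_measurable lebesgue" for N
  proof -
    have "set_integrable lebesgue (cball 0 (real N)) b"
      using assms by (simp add: locally_integrable_def)
    then show ?thesis
      unfolding set_integrable_def by (auto dest: borel_measurable_integrable)
  qed
  moreover have "(\<lambda>N. indicator (cball 0 (real N)) x * b x) \<longlonglongrightarrow> b x" for x
  proof (rule tendsto_eventually)
    obtain N :: nat where "norm x \<le> N" using real_arch_simple by blast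
    then show "\<forall>\<^sub>F M in sequentially. indicator (cball 0 (real M)) x * b x = b x"
      unfolding eventually_sequentially by (intro exI[of _ N]) auto
  qed
  ultimately show ?thesis
    by (rule borel_measurable_LIMSEQ_real[rotated])
qed

lemma Lipschitz_spaceD:
  assumes "b \<in> Lipschitz_space \<beta>"
  shows "\<exists>g L. 0 \<le> L \<and> (AE x in lebesgue. b x = g x) \<and>
    (\<forall>x y. \<bar>g x - g y\<bar> \<le> L * norm (x - y) powr \<beta>)"
proof -
  from assms obtain g C where "AE x in lebesgue. b x = g x"
    and C: "\<forall>x y. \<bar>g x - g y\<bar> \<le> C * norm (x - y) powr \<beta>"
    unfolding Lipschitz_space_def by auto
  moreover have "\<bar>g x - g y\<bar> \<le> max C 0 * norm (x - y) powr \<beta>" for x y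
    by (rule order_trans[OF C[rule_format]]) (auto intro!: mult_right_mono)
  ultimately show ?thesis by (intro exI[of _ g] exI[of _ "max C 0"]) auto
qed

lemma borel_measurable_commutator [measurable]:
  fixes f b :: "real^'n \<Rightarrow> real"
  assumes [measurable]: "b \<in> borel_measurable lebesgue"
  shows "commutator b f \<in> borel_measurable lebesgue"
  unfolding commutator_def by measurable

text \<open>From t <= 1 + t^p for t >= 0 and p >= 1, the integral over K is at most r times the
  measure of K plus the modular.\<close>

lemma Lvar_locally_integrable:
  fixes f p :: "real^'n \<Rightarrow> real"
  assumes [measurable]: "f \<in> borel_measurable lebesgue" "p \<in> borel_measurable lebesgue"
    and p: "\<And>x. 1 \<le> p x" and r: "0 < r" "modular p (\<lambda>x. f x / r) \<le> 1"
    and K: "K \<in> sets lebesgue" "emeasure lebesgue K < \<infinity>"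
  shows "(\<integral>\<^sup>+x\<in>K. ennreal \<bar>f x\<bar> \<partial>lebesgue) < \<infinity>"
proof -
  note K(1)[measurable]
  have "(\<integral>\<^sup>+x\<in>K. ennreal \<bar>f x\<bar> \<partial>lebesgue)
      \<le> (\<integral>\<^sup>+x. ennreal r * (indicator K x + ennreal (\<bar>f x / r\<bar> powr p x)) \<partial>lebesgue)"
  proof (rule nn_integral_mono)
    fix x
    have "\<bar>f x / r\<bar> \<le> 1 + \<bar>f x / r\<bar> powr p x"
    proof (cases "\<bar>f x / r\<bar> \<le> 1")
      case False
      then have "\<bar>f x / r\<bar> powr 1 \<le> \<bar>f x / r\<bar> powr p x" using p[of x] by (intro powr_mono) auto
      then show ?thesis using False by simp
    qed (simp add: add_increasing2)
    then have "\<bar>f x\<bar> \<le> r * (1 + \<bar>f x / r\<bar> powr p x)"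
      using r by (simp add: abs_divide field_simps)
    then have "ennreal \<bar>f x\<bar> \<le> ennreal (r * (1 + \<bar>f x / r\<bar> powr p x))"
      by (rule ennreal_leI)
    also have "\<dots> = ennreal r * (1 + ennreal (\<bar>f x / r\<bar> powr p x))"
      using r by (simp add: ennreal_mult)
    finally show "ennreal \<bar>f x\<bar> * indicator K x \<le> ennreal r * (indicator K x + ennreal (\<bar>f x / r\<bar> powr p x))"
      by (auto simp: indicator_def)
  qed
  also have "\<dots> = ennreal r * (emeasure lebesgue K + modular p (\<lambda>x. f x / r))"
    by (simp add: nn_integral_cmult nn_integral_add modular_def)
  also have "\<dots> < \<infinity>"
    using K r by (auto simp: ennreal_mult_less_top intro: order.strict_trans1)
  finally show ?thesis .
qed

text \<open>Writing \<open>1/p = 1/q + \<beta>/n\<close>, Hoelder's inequality bounds the fractional averages of \<open>f\<close> by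
  a power of \<open>M h\<close> for \<open>h = \<bar>f\<bar> powr (p/s)\<close>, where \<open>s = q (n - \<beta>) / n\<close> is an exponent on
  which \<open>M\<close> is bounded and \<open>modular s h = modular p f\<close>.\<close>

lemma commutator_bounded_if_Lipschitz:
  fixes b p q :: "real^'n \<Rightarrow> real"
  assumes b: "locally_integrable b" and \<beta>: "0 < \<beta>" "\<beta> < 1"
    and lip: "b \<in> Lipschitz_space \<beta>" and nonneg: "AE x in lebesgue. 0 \<le> b x"
    and pq: "(p, q) \<in> exponent_pairs \<beta>"
  shows "bounded_operator (commutator b) p q"
proof -
  define \<theta> where "\<theta> = \<beta> / real CARD('n)"
  note pq_facts = exponent_pairsD[OF pq \<beta>(2) \<theta>_def]
  note [measurable] = pq_facts(3,4) locally_integrable_measurable[OF b]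
  define s where "s x = q x * (1 - \<theta>)" for x
  have s: "s \<in> maximal_exponents" using pq_facts(7) by (simp add: s_def[abs_def])
  note s_facts = maximal_exponentsD[OF s]
  note [measurable] = s_facts(1)
  have s0: "0 \<le> s x" for x using s_facts(2)[of x] by simp
  obtain Cs where Cs: "0 < Cs"
    and Mfin: "\<forall>f\<in>Lvar s. AE x in lebesgue. \<bar>enn2ereal (maximal f x)\<bar> \<noteq> \<infinity>"
    and Mbound: "\<forall>f\<in>borel_measurable lebesgue. \<forall>r>0. modular s (\<lambda>x. f x / r) \<le> 1 \<longrightarrow>
      modular s (\<lambda>x. real_of_ereal (enn2ereal (maximal f x)) / (Cs * r)) \<le> 1"
    using bounded_operator_modular[OF s0 s_facts(3)] by (elim exE conjE) (rule that)
  obtain g L where L: "0 \<le> L" and bg: "AE x in lebesgue. b x = g x"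
    and g: "\<forall>x y. \<bar>g x - g y\<bar> \<le> L * norm (x - y) powr \<beta>"
    using Lipschitz_spaceD[OF lip] by (elim exE conjE) (rule that)
  define C1 where "C1 = L * real CARD('n) powr \<beta>"
  have C1: "0 \<le> C1" using L by (simp add: C1_def)
  \<comment> \<open>M h enters the pointwise bound to the power 1 - \<theta>, and so does its
    operator constant \<open>Cs\<close>. The added 1 keeps \<open>C\<close> positive when b is
    constant.\<close>
  define C where "C = (C1 + 1) * Cs powr (1 - \<theta>)"
  have C: "0 < C" using C1 Cs by (simp add: C_def)
  have key: "(AE x in lebesgue. \<bar>commutator b f x\<bar> \<noteq> \<infinity>) \<and>
      modular q (\<lambda>x. real_of_ereal (commutator b f x) / (C * r)) \<le> 1"
    if [measurable]: "f \<in> borel_measurable lebesgue" and r: "0 < r" "modular p (\<lambda>x. f x / r) \<le> 1" for f r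
  proof -
    define h where "h x = \<bar>f x / r\<bar> powr (p x / s x)" for x
    have [measurable]: "h \<in> borel_measurable lebesgue" unfolding h_def by measurable
    have "modular s (\<lambda>x. h x / 1) = modular p (\<lambda>x. f x / r)"
    proof -
      have "p x / s x * s x = p x" for x using s_facts(2)[of x] by simp
      then show ?thesis by (simp add: modular_def h_def powr_powr)
    qed
    with r have hs: "modular s (\<lambda>x. h x / 1) \<le> 1" by simp
    let ?M = "\<lambda>x. real_of_ereal (enn2ereal (maximal h x))"
    have "h \<in> Lvar s" using hs by (rule Lvar_modularI[rotated 2]) auto
    then have Mh: "AE x in lebesgue. \<bar>enn2ereal (maximal h x)\<bar> \<noteq> \<infinity>" by (rule Mfin[rule_format])
    have Mh1: "modular s (\<lambda>x. ?M x / Cs) \<le> 1"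
      using Mbound[rule_format, OF _ _ hs] by simp
    have loc: "(\<integral>\<^sup>+x\<in>cball 0 (real N). ennreal \<bar>f x\<bar> \<partial>lebesgue) < \<infinity>" for N
      using pq_facts r
      by (intro Lvar_locally_integrable[where p = p and r = r]) (auto simp: emeasure_cball)
    have main: "AE x in lebesgue. \<bar>commutator b f x\<bar> \<noteq> \<infinity> \<and>
        \<bar>real_of_ereal (commutator b f x)\<bar> \<le> C1 * (r * ?M x powr (1 - \<theta>))"
      using Mh bg nonneg maximal_finite_if_large_averages_bounded[OF _ loc, simplified]
    proof eventually_elim
      case (elim x)
      define m where "m = ?M x"
      have m: "maximal h x = ennreal m" "0 \<le> m"
        using elim(1) by (cases "maximal h x"; simp add: m_def)+
      define D where "D = r * m powr (1 - \<theta>)"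
      have D: "0 \<le> D" using r by (simp add: D_def)
      have avg: "average f Q \<le> ennreal (D * measure lebesgue Q powr - \<theta>)"
        if Q: "Q \<in> cubes" "x \<in> Q" for Q
      proof -
        have "average h Q \<le> ennreal m" unfolding m(1)[symmetric] by (rule average_le_maximal) fact+
        then show ?thesis
          unfolding D_def using pq_facts m(2) r Q(1)
          by (intro fractional_average_bound[where p = p and q = q])
             (auto simp: h_def[abs_def] s_def intro: order.strict_trans2[OF zero_less_one])
      qed
      \<comment> \<open>For |Q| >= 1 the factor |Q|^(-\<theta>) is at most 1, so D, which depends on
        x through M h(x), bounds all large averages.\<close>
      have "average f Q \<le> ennreal D" if Q: "Q \<in> cubes" "x \<in> Q" "1 \<le> measure lebesgue Q" for Q
      proof (rule order_trans[OF avg[OF Q(1,2)]], rule ennreal_leI)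
        have "measure lebesgue Q powr - \<theta> \<le> 1"
          using Q(3) pq_facts(1) powr_mono[of "-\<theta>" 0 "measure lebesgue Q"] by simp
        then show "D * measure lebesgue Q powr - \<theta> \<le> D" using D by (intro mult_left_le) auto
      qed
      with elim(4) have fin: "maximal f x < \<infinity>" by (auto simp: less_top)
      have "AE y in lebesgue. \<bar>b y - b x\<bar> \<le> L * norm (y - x) powr \<beta>"
        using bg
      proof eventually_elim
        case (elim y)
        with \<open>b x = g x\<close> g[rule_format, of y x] show ?case by simp
      qed
      from commutator_pointwise_bound[OF _ _ \<beta>(1) elim(3) L D this _ fin] avg
      show ?case by (simp add: C1_def D_def m_def \<theta>_def)
    qed
    \<comment> \<open>The pointwise bound contains (M h)^(1 - \<theta>), whose power q is (M
      h)^s.\<close>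
    have "modular q (\<lambda>x. real_of_ereal (commutator b f x) / (C * r)) \<le> modular s (\<lambda>x. ?M x / Cs)"
      unfolding modular_def
    proof (rule nn_integral_mono_AE)
      show "AE x in lebesgue. ennreal (\<bar>real_of_ereal (commutator b f x) / (C * r)\<bar> powr q x) \<le>
          ennreal (\<bar>?M x / Cs\<bar> powr s x)"
        using main
      proof eventually_elim
        case (elim x)
        have M0: "0 \<le> ?M x" by (simp add: real_of_ereal_pos)
        have "\<bar>real_of_ereal (commutator b f x)\<bar> \<le> (C1 + 1) * (r * ?M x powr (1 - \<theta>))"
          using elim r by (smt (verit) mult_right_mono mult_nonneg_nonneg powr_ge_zero)
        then have "\<bar>real_of_ereal (commutator b f x) / (C * r)\<bar> \<le> (C1 + 1) * (r * ?M x powr (1 - \<theta>)) / (C * r)"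
        proof -
          have "0 < C * r" using C r by simp
          then show ?thesis
            using divide_right_mono[OF \<open>_ \<le> (C1 + 1) * (r * ?M x powr (1 - \<theta>))\<close>, of "C * r"]
            by (simp only: abs_divide abs_of_pos less_imp_le)
        qed
        also have "\<dots> = (?M x / Cs) powr (1 - \<theta>)"
          using C1 r Cs M0 by (simp add: C_def powr_divide)
        finally have "\<bar>real_of_ereal (commutator b f x) / (C * r)\<bar> powr q x \<le> ((?M x / Cs) powr (1 - \<theta>)) powr q x"
          using pq_facts(6)[of x] by (intro powr_mono2 abs_ge_zero) auto
        also have "\<dots> = \<bar>?M x / Cs\<bar> powr s x"
          using M0 Cs by (simp add: powr_powr s_def mult.commute)
        finally show ?case by (rule ennreal_leI)
      qed
    qed
    with Mh1 main show ?thesis by (auto elim: eventually_mono)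
  qed
  show ?thesis
    unfolding bounded_operator_def
  proof (intro exI[of _ C] ballI conjI)
    fix f assume f: "f \<in> Lvar p"
    then have [measurable]: "f \<in> borel_measurable lebesgue" by (simp add: Lvar_def)
    obtain r where "0 < r" "modular p (\<lambda>x. f x / r) \<le> 1"
      using Lvar_modular_le_1[OF pq_facts(3,5) f] by blast
    with key show "AE x in lebesgue. \<bar>commutator b f x\<bar> \<noteq> \<infinity>" by simp
    show "Lvar_norm q (\<lambda>x. real_of_ereal (commutator b f x)) \<le> ennreal C * Lvar_norm p f"
      using key by (intro Lvar_norm_le_mult C f) auto
  qed
qed

section \<open>Bounded commutators have finite oscillation\<close>

text \<open>A cube sticking out of a larger Q can be slid back into it without losing any point it
  shares with Q: each coordinate of its corner is clamped to the interval from a to a + l - l'. If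
  its side is at least that of Q, then Q itself serves.\<close>

lemma cube_shifted_inside:
  fixes Q Q' :: "(real^'n) set"
  assumes "Q \<in> cubes" "Q' \<in> cubes"
  shows "\<exists>R\<in>cubes. R \<subseteq> Q \<and> Q \<inter> Q' \<subseteq> R \<and> measure lebesgue R \<le> measure lebesgue Q'"
proof -
  from assms obtain a l a' l' where Q: "Q = box a (a + vec l)" "0 < l"
    and Q': "Q' = box a' (a' + vec l')" "0 < l'" by (metis cubesE)
  show ?thesis
  proof (cases "l \<le> l'")
    case True
    then have "measure lebesgue Q \<le> measure lebesgue Q'"
      using Q(2) Q'(2) unfolding Q(1) Q'(1) by (simp only: measure_box_vec less_imp_le power_mono)
    with assms show ?thesis by blast
  next
    case False
    define c where "c = (\<chi> i. max (a $ i) (min (a' $ i) (a $ i + l - l')))"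
    have "box c (c + vec l') \<subseteq> Q"
    proof
      fix y assume y: "y \<in> box c (c + vec l')"
      have "a $ i < y $ i \<and> y $ i < a $ i + l" for i
      proof -
        have "c $ i < y $ i" "y $ i < c $ i + l'" using y by (auto simp: mem_box_cart)
        moreover have "a $ i \<le> c $ i" "c $ i + l' \<le> a $ i + l"
          using False by (auto simp: c_def)
        ultimately show ?thesis by linarith
      qed
      then show "y \<in> Q" by (auto simp: Q mem_box_cart)
    qed
    moreover have "Q \<inter> Q' \<subseteq> box c (c + vec l')"
    proof
      fix y assume y: "y \<in> Q \<inter> Q'"
      have "c $ i < y $ i \<and> y $ i < c $ i + l'" for i
      proof -
        have "a $ i < y $ i" "y $ i < a $ i + l" "a' $ i < y $ i" "y $ i < a' $ i + l'"
          using y by (auto simp: Q Q' mem_box_cart)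
        then show ?thesis by (auto simp: c_def)
      qed
      then show "y \<in> box c (c + vec l')" by (auto simp: mem_box_cart)
    qed
    moreover have "measure lebesgue (box c (c + vec l')) = measure lebesgue Q'"
      using Q'(2) unfolding Q'(1) by (simp only: measure_box_vec less_imp_le)
    ultimately show ?thesis
      using box_vec_in_cubes[OF Q'(2), of c] by (intro bexI[of _ "box c (c + vec l')"]) auto
  qed
qed

lemma maximal_indicator:
  fixes Q :: "(real^'n) set"
  assumes Q: "Q \<in> cubes" "x \<in> Q"
  shows "maximal (indicator Q) x = 1"
proof (rule antisym)
  show "maximal (indicator Q) x \<le> 1"
    unfolding maximal_def
  proof (rule SUP_least, clarify)
    fix R :: "(real^'n) set" assume R: "R \<in> cubes"
    have "(\<integral>\<^sup>+y\<in>R. ennreal \<bar>indicator Q y\<bar> \<partial>lebesgue) \<le> (\<integral>\<^sup>+y. indicator R y \<partial>lebesgue)"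
      by (intro nn_integral_mono) (auto simp: indicator_def)
    then have "(\<integral>\<^sup>+y\<in>R. ennreal \<bar>indicator Q y\<bar> \<partial>lebesgue) \<le> ennreal (1 * measure lebesgue R)"
      using R by (simp add: sets_cube emeasure_cube del: emeasure_completion)
    then show "average (indicator Q) R \<le> 1"
      using average_le_iff[OF R, of 1] by simp
  qed
  have "(\<integral>\<^sup>+y\<in>Q. ennreal \<bar>indicator Q y\<bar> \<partial>lebesgue) = (\<integral>\<^sup>+y. indicator Q y \<partial>lebesgue)"
    by (intro nn_integral_cong) (auto simp: indicator_def)
  then have "average (indicator Q) Q = 1"
    unfolding average_def using Q emeasure_cube_neq[OF Q(1)]
    by (simp add: sets_cube ennreal_divide_self less_top[symmetric])
  then show "1 \<le> maximal (indicator Q) x"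
    using average_le_maximal[OF Q] by metis
qed

text \<open>Since b \<chi>_Q vanishes off Q, a competing cube may be replaced by the cube of
  \<open>cube_shifted_inside\<close>: the integral does not decrease and the measure does not
  increase.\<close>

lemma maximal_eq_local_maximal:
  fixes Q :: "(real^'n) set"
  assumes Q: "Q \<in> cubes" "x \<in> Q"
  shows "maximal (\<lambda>y. b y * indicator Q y) x = local_maximal Q b x"
proof (rule antisym)
  show "maximal (\<lambda>y. b y * indicator Q y) x \<le> local_maximal Q b x"
    unfolding maximal_def
  proof (rule SUP_least, clarify)
    fix Q' :: "(real^'n) set" assume Q': "Q' \<in> cubes" "x \<in> Q'"
    obtain R where R: "R \<in> cubes" "R \<subseteq> Q" "Q \<inter> Q' \<subseteq> R" "measure lebesgue R \<le> measure lebesgue Q'"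
      using cube_shifted_inside[OF Q(1) Q'(1)] by blast
    have "average (\<lambda>y. b y * indicator Q y) Q' \<le> average b R"
      unfolding average_def divide_ennreal_def
    proof (intro mult_mono)
      show "(\<integral>\<^sup>+y\<in>Q'. ennreal \<bar>b y * indicator Q y\<bar> \<partial>lebesgue) \<le> (\<integral>\<^sup>+y\<in>R. ennreal \<bar>b y\<bar> \<partial>lebesgue)"
        using R(3) by (intro nn_integral_mono) (auto simp: indicator_def)
      show "inverse (emeasure lebesgue R) \<ge> inverse (emeasure lebesgue Q')"
        using R Q' measure_cube_pos[OF R(1)] measure_cube_pos[OF Q'(1)]
        by (simp add: emeasure_cube inverse_ennreal ennreal_leI le_imp_inverse_le del: emeasure_completion)
    qed auto
    also have "\<dots> \<le> local_maximal Q b x"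
      using R Q Q' by (intro average_le_local_maximal) auto
    finally show "average (\<lambda>y. b y * indicator Q y) Q' \<le> local_maximal Q b x" .
  qed
  show "local_maximal Q b x \<le> maximal (\<lambda>y. b y * indicator Q y) x"
    unfolding local_maximal_def
  proof (rule SUP_least, clarify)
    fix R :: "(real^'n) set" assume R: "R \<in> cubes" "x \<in> R" "R \<subseteq> Q"
    then have "average b R = average (\<lambda>y. b y * indicator Q y) R"
      by (intro average_cong) auto
    also have "\<dots> \<le> maximal (\<lambda>y. b y * indicator Q y) x"
      by (rule average_le_maximal) fact+
    finally show "average b R \<le> maximal (\<lambda>y. b y * indicator Q y) x" .
  qed
qed

section \<open>Norms of characteristic functions of cubes\<close>

lemma indicator_cube_in_Lvar:
  fixes Q :: "(real^'n) set"
  assumes Q: "Q \<in> cubes" and p: "\<And>x. 1 \<le> p x"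
  shows "indicator Q \<in> Lvar p"
proof -
  have "modular p (\<lambda>x. indicator Q x / 1) \<le> (\<integral>\<^sup>+x. indicator Q x \<partial>lebesgue)"
    unfolding modular_def
    by (intro nn_integral_mono) (auto simp: indicator_def)
  also have "\<dots> < \<infinity>" using Q by (simp add: sets_cube emeasure_cube del: emeasure_completion)
  finally have "modular p (\<lambda>x. indicator Q x / 1) < \<infinity>" .
  then show ?thesis
    unfolding Lvar_def using sets_cube[OF Q] by (intro CollectI conjI exI[of _ 1]) auto
qed

text \<open>A Hoelder inequality for \<chi>_Q = \<chi>_Q \<chi>_Q with 1/p = 1/q + \<theta>, where
  |Q|^\<theta> is the norm of \<chi>_Q for the constant exponent 1/\<theta>. Pointwise Young with
  weights p/q and p \<theta> bounds the p-modular by the sum of two modulars that are at most 1; the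
  factor 2 and p >= 1 supply the 1/2 that absorbs this sum.\<close>

lemma Lvar_norm_indicator_le:
  fixes p q :: "real^'n \<Rightarrow> real"
  assumes [measurable]: "p \<in> borel_measurable lebesgue" "q \<in> borel_measurable lebesgue"
    and \<theta>: "0 < \<theta>" "\<theta> < 1"
    and p: "\<And>x. 1 \<le> p x" and q: "\<And>x. 1 \<le> q x"
    and pq: "AE x in lebesgue. 1 / q x = 1 / p x - \<theta>"
    and Q: "Q \<in> cubes"
  shows "Lvar_norm p (indicator Q) \<le> ennreal (2 * measure lebesgue Q powr \<theta>) * Lvar_norm q (indicator Q)"
proof (rule Lvar_norm_le_mult)
  define \<mu> where "\<mu> = measure lebesgue Q"
  have \<mu>: "0 < \<mu>" unfolding \<mu>_def by (rule measure_cube_pos[OF Q])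
  show "0 < 2 * measure lebesgue Q powr \<theta>" using \<mu> by (simp add: \<mu>_def)
  have [measurable]: "Q \<in> sets lebesgue" using Q by (rule sets_cube)
  show "indicator Q \<in> Lvar q" by (rule indicator_cube_in_Lvar[OF Q q])
  show "indicator Q \<in> borel_measurable lebesgue" by measurable
  fix r :: real assume r: "0 < r" "modular q (\<lambda>x. indicator Q x / r) \<le> 1"
  have "modular p (\<lambda>x. indicator Q x / (2 * \<mu> powr \<theta> * r))
    \<le> (\<integral>\<^sup>+x. ennreal (1/2) * (ennreal (\<bar>indicator Q x / r\<bar> powr q x) + ennreal (1 / \<mu>) * indicator Q x) \<partial>lebesgue)"
    unfolding modular_def
  proof (rule nn_integral_mono_AE)
    show "AE x in lebesgue. ennreal (\<bar>indicator Q x / (2 * \<mu> powr \<theta> * r)\<bar> powr p x)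
        \<le> ennreal (1/2) * (ennreal (\<bar>indicator Q x / r\<bar> powr q x) + ennreal (1 / \<mu>) * indicator Q x)"
      using pq
    proof eventually_elim
      case (elim x)
      show ?case
      proof (cases "x \<in> Q")
        case True
        have p0: "0 < p x" and q0: "0 < q x" using p[of x] q[of x] by auto
        have "p x / q x + p x * \<theta> = p x * (1 / q x + \<theta>)" by (simp add: algebra_simps)
        also have "\<dots> = 1" using p0 elim by simp
        finally have exps: "p x / q x + p x * \<theta> = 1" .
        moreover have nn: "0 \<le> p x / q x" "0 \<le> p x * \<theta>" using p0 q0 \<theta> by auto
        ultimately have le1: "p x / q x \<le> 1" "p x * \<theta> \<le> 1" by auto
        have "(1 / (2 * \<mu> powr \<theta> * r)) powr p x
            = (1 / 2) powr p x * (((1 / r) powr q x) powr (p x / q x) * (1 / \<mu>) powr (p x * \<theta>))"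
          using r \<mu> q0 by (simp add: powr_powr powr_divide powr_mult mult_ac)
        also have "\<dots> \<le> 1 / 2 * ((1 / r) powr q x + 1 / \<mu>)"
        proof (rule mult_mono)
          have "(1 / 2) powr p x \<le> (1 / 2 :: real) powr 1" using p[of x] by (intro powr_mono') auto
          then show "(1 / 2) powr p x \<le> (1 / 2 :: real)" by simp
          have "((1 / r) powr q x) powr (p x / q x) * (1 / \<mu>) powr (p x * \<theta>)
              \<le> p x / q x * (1 / r) powr q x + p x * \<theta> * (1 / \<mu>)"
            using r \<mu> nn exps by (intro Youngs_inequality_0) auto
          also have "\<dots> \<le> (1 / r) powr q x + 1 / \<mu>"
            using le1 nn \<mu> by (intro add_mono mult_left_le_one_le) auto
          finally show "((1 / r) powr q x) powr (p x / q x) * (1 / \<mu>) powr (p x * \<theta>) \<le> (1 / r) powr q x + 1 / \<mu>" .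
        qed auto
        finally have "ennreal ((1 / (2 * \<mu> powr \<theta> * r)) powr p x) \<le> ennreal (1 / 2 * ((1 / r) powr q x + 1 / \<mu>))"
          by (rule ennreal_leI)
        also have "\<dots> = ennreal (1/2) * (ennreal ((1 / r) powr q x) + ennreal (1 / \<mu>))"
          using \<mu> by (subst ennreal_mult) auto
        finally show ?thesis using True r \<mu> by simp
      qed simp
    qed
  qed
  also have "\<dots> = ennreal (1/2) * (modular q (\<lambda>x. indicator Q x / r) + ennreal (1 / \<mu>) * emeasure lebesgue Q)"
    by (simp add: nn_integral_cmult nn_integral_add modular_def)
  also have "\<dots> \<le> ennreal (1/2) * (1 + ennreal (1 / \<mu>) * ennreal \<mu>)"
    using r by (intro mult_left_mono add_mono) (auto simp: emeasure_cube[OF Q] \<mu>_def)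
  also have "\<dots> = ennreal (1/2) * (ennreal 1 + ennreal 1)"
    using \<mu> by (simp add: ennreal_mult[symmetric])
  also have "\<dots> = 1"
  proof -
    have "ennreal (1/2) * (ennreal 1 + ennreal 1) = ennreal (1/2 * (1 + 1))"
      by (subst ennreal_mult, simp, simp, subst ennreal_plus) auto
    then show ?thesis by simp
  qed
  finally show "modular p (\<lambda>x. indicator Q x / (2 * measure lebesgue Q powr \<theta> * r)) \<le> 1"
    by (simp add: \<mu>_def)
qed

lemma oscillation_finite_if_bounded:
  fixes b p q :: "real^'n \<Rightarrow> real"
  assumes b: "locally_integrable b" and \<beta>: "0 < \<beta>" "\<beta> < 1"
    and pq: "(p, q) \<in> exponent_pairs \<beta>"
    and bdd: "bounded_operator (commutator b) p q"
  shows "oscillation \<beta> q b < \<infinity>"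
proof -
  define \<theta> where "\<theta> = \<beta> / real CARD('n)"
  note pq_facts = exponent_pairsD[OF pq \<beta>(2) \<theta>_def]
  note [measurable] = pq_facts(3,4) locally_integrable_measurable[OF b]
  have q0: "0 \<le> q x" for x using pq_facts(6)[of x] by simp
  obtain C :: real where C: "\<forall>f\<in>Lvar p. (AE x in lebesgue. \<bar>commutator b f x\<bar> \<noteq> \<infinity>) \<and>
      Lvar_norm q (\<lambda>x. real_of_ereal (commutator b f x)) \<le> ennreal C * Lvar_norm p f"
    using bdd unfolding bounded_operator_def by blast
  have "oscillation \<beta> q b \<le> ennreal (2 * max C 0)"
    unfolding oscillation_def \<theta>_def[symmetric]
  proof (rule SUP_least)
    fix Q :: "(real^'n) set" assume Q: "Q \<in> cubes"
    define \<mu> where "\<mu> = measure lebesgue Q"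
    have \<mu>: "0 < \<mu>" unfolding \<mu>_def by (rule measure_cube_pos[OF Q])
    have [measurable]: "Q \<in> sets lebesgue" using Q by (rule sets_cube)
    let ?g = "\<lambda>x. (b x - enn2real (local_maximal Q b x)) * indicator Q x"
    let ?T = "commutator b (indicator Q)"
    have ind: "indicator Q \<in> Lvar p" by (rule indicator_cube_in_Lvar[OF Q pq_facts(5)])
    have fin: "AE x in lebesgue. \<bar>?T x\<bar> \<noteq> \<infinity>" using C ind by blast
    have "Lvar_norm q ?g \<le> Lvar_norm q (\<lambda>x. real_of_ereal (?T x))"
    proof (rule Lvar_norm_mono[OF q0])
      note borel_measurable_maximal_lebesgue[measurable]
      show "?g \<in> borel_measurable lebesgue" by measurable
      show "AE x in lebesgue. \<bar>?g x\<bar> \<le> \<bar>real_of_ereal (?T x)\<bar>"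
        using fin
      proof eventually_elim
        case (elim x)
        show ?case
        proof (cases "x \<in> Q")
          case True
          have "?T x = ereal (b x) - enn2ereal (local_maximal Q b x)"
            using Q True by (simp add: commutator_def one_ennreal.rep_eq maximal_indicator maximal_eq_local_maximal)
          \<comment> \<open>Finiteness of the commutator forces M_Q b(x) to be finite, so
            \<open>enn2real\<close> loses nothing here.\<close>
          with elim True show ?thesis
            by (cases "local_maximal Q b x") auto
        next
          case False
          then have "?g x = 0" by simp
          then show ?thesis by (metis abs_ge_zero abs_zero)
        qed
      qed
    qed
    also have "\<dots> \<le> ennreal C * Lvar_norm p (indicator Q)" using C ind by blast
    also have "\<dots> \<le> ennreal (max C 0) * (ennreal (2 * \<mu> powr \<theta>) * Lvar_norm q (indicator Q))"
      unfolding \<mu>_def using pq_facts Q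
      by (intro mult_mono Lvar_norm_indicator_le) (auto intro: ennreal_leI)
    also have "\<dots> = ennreal (2 * max C 0 * \<mu> powr \<theta>) * Lvar_norm q (indicator Q)"
    proof -
      have "ennreal (2 * max C 0 * \<mu> powr \<theta>) = ennreal (max C 0) * ennreal (2 * \<mu> powr \<theta>)"
        by (subst ennreal_mult[symmetric]) (auto simp: mult_ac)
      then show ?thesis by (simp only: mult.assoc)
    qed
    finally have le: "Lvar_norm q ?g \<le> ennreal (2 * max C 0 * \<mu> powr \<theta>) * Lvar_norm q (indicator Q)" .
    have "Lvar_norm q ?g / Lvar_norm q (indicator Q) \<le> ennreal (2 * max C 0 * \<mu> powr \<theta>)"
    \<comment> \<open>A zero denominator makes the numerator zero by \<open>le\<close>, and 0/0 = 0
      in \<open>ennreal\<close>; an infinite denominator makes the quotient zero.\<close>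
    proof (cases "Lvar_norm q (indicator Q) = 0 \<or> Lvar_norm q (indicator Q) = \<infinity>")
      case True
      with le show ?thesis by (auto simp: divide_ennreal_def)
    next
      case False
      then show ?thesis
        using le by (intro divide_le_posI_ennreal) (auto simp: mult.commute zero_less_iff_neq_zero)
    qed
    then have "ennreal (1 / \<mu> powr \<theta>) * (Lvar_norm q ?g / Lvar_norm q (indicator Q))
        \<le> ennreal (1 / \<mu> powr \<theta>) * ennreal (2 * max C 0 * \<mu> powr \<theta>)"
      by (rule mult_left_mono) simp
    also have "\<dots> = ennreal (2 * max C 0)"
      using \<mu> by (simp add: ennreal_mult[symmetric])
    finally show "ennreal (1 / measure lebesgue Q powr \<theta>) *
        (Lvar_norm q ?g / Lvar_norm q (indicator Q)) \<le> ennreal (2 * max C 0)"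
      by (simp add: \<mu>_def)
  qed
  also have "\<dots> < \<infinity>" by simp
  finally show ?thesis .
qed

section \<open>Finite oscillation implies the Lipschitz condition\<close>

text \<open>If r < 1 is admissible, then (1/r)^q >= 1/r on Q, so |Q|/r <= 1. Every admissible r is
  therefore at least min 1 |Q|.\<close>

lemma Lvar_norm_indicator_pos:
  fixes Q :: "(real^'n) set"
  assumes Q: "Q \<in> cubes" and q: "\<And>x. 1 \<le> q x"
  shows "0 < Lvar_norm q (indicator Q)"
proof -
  define \<mu> where "\<mu> = measure lebesgue Q"
  have \<mu>: "0 < \<mu>" unfolding \<mu>_def by (rule measure_cube_pos[OF Q])
  have [measurable]: "Q \<in> sets lebesgue" using Q by (rule sets_cube)
  have ge: "ennreal (min 1 \<mu>) \<le> ennreal r" if r: "0 < r" "modular q (\<lambda>x. indicator Q x / r) \<le> 1" for r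
  proof (cases "r < 1")
    case True
    have "ennreal (1 / r) * emeasure lebesgue Q = (\<integral>\<^sup>+x. ennreal (1 / r) * indicator Q x \<partial>lebesgue)"
      by (rule nn_integral_cmult_indicator[symmetric]) fact
    also have "\<dots> \<le> modular q (\<lambda>x. indicator Q x / r)"
      unfolding modular_def
    proof (rule nn_integral_mono)
      fix x
      have "(1 / r) powr 1 \<le> (1 / r) powr q x" using True r q[of x] by (intro powr_mono) auto
      then show "ennreal (1 / r) * indicator Q x \<le> ennreal (\<bar>indicator Q x / r\<bar> powr q x)"
        using r by (auto simp: indicator_def intro!: ennreal_leI)
    qed
    finally have "ennreal (1 / r) * ennreal \<mu> \<le> ennreal 1"
      using r by (simp add: emeasure_cube[OF Q] \<mu>_def)
    then have "1 / r * \<mu> \<le> 1" using r \<mu> by (simp add: ennreal_mult[symmetric])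
    then have "\<mu> \<le> r" using r by (simp add: field_simps)
    then show ?thesis by (intro ennreal_leI) auto
  qed (auto intro!: ennreal_leI)
  have "ennreal (min 1 \<mu>) \<le> Lvar_norm q (indicator Q)"
    unfolding Lvar_norm_def if_P[OF indicator_cube_in_Lvar[OF Q q]]
    by (rule INF_greatest) (use ge in auto)
  moreover have "0 < ennreal (min 1 \<mu>)" using \<mu> by simp
  ultimately show ?thesis by (rule order.strict_trans2[rotated])
qed

lemma locally_integrable_cube:
  assumes b: "locally_integrable b" and Q: "Q \<in> cubes"
  shows "set_integrable lebesgue Q b"
proof -
  have "set_integrable lebesgue (closure Q) b"
    using b bounded_cube[OF Q] by (simp add: locally_integrable_def)
  then show ?thesis
    by (rule set_integrable_subset) (auto simp: closure_subset sets_cube[OF Q])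
qed

text \<open>On Q, M_Q b coincides with M (b \<chi>_Q), and b \<chi>_Q is integrable.\<close>

lemma local_maximal_finite_AE:
  fixes b :: "real^'n \<Rightarrow> real"
  assumes b: "locally_integrable b" and Q: "Q \<in> cubes"
  shows "AE x in lebesgue. x \<in> Q \<longrightarrow> local_maximal Q b x < \<infinity>"
proof -
  have [measurable]: "Q \<in> sets lebesgue" "b \<in> borel_measurable lebesgue"
    using Q b by (auto intro: sets_cube locally_integrable_measurable)
  have "set_integrable lebesgue Q b"
    by (rule locally_integrable_cube[OF b Q])
  then have "integrable lebesgue (\<lambda>x. b x * indicator Q x)"
    by (simp add: set_integrable_def mult.commute)
  then have "(\<integral>\<^sup>+x. ennreal \<bar>b x * indicator Q x\<bar> \<partial>lebesgue) < \<infinity>"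
    by (simp add: integrable_iff_bounded)
  then have "AE x in lebesgue. maximal (\<lambda>y. b y * indicator Q y) x < \<infinity>"
    by (intro maximal_finite_AE) auto
  then show ?thesis
    by eventually_elim (use Q in \<open>auto simp: maximal_eq_local_maximal\<close>)
qed

lemma average_ge:
  assumes Q: "Q \<in> cubes" and c: "0 \<le> c" and ge: "AE x in lebesgue. x \<in> Q \<longrightarrow> c \<le> \<bar>f x\<bar>"
  shows "ennreal c \<le> average f Q"
proof -
  have "ennreal c * emeasure lebesgue Q = (\<integral>\<^sup>+x. ennreal c * indicator Q x \<partial>lebesgue)"
    using sets_cube[OF Q] by (simp add: nn_integral_cmult_indicator del: emeasure_completion)
  also have "\<dots> \<le> (\<integral>\<^sup>+x\<in>Q. ennreal \<bar>f x\<bar> \<partial>lebesgue)"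
    using ge by (intro nn_integral_mono_AE) (auto elim!: eventually_mono simp: indicator_def intro: ennreal_leI)
  finally have "ennreal c * emeasure lebesgue Q / emeasure lebesgue Q \<le> average f Q"
    unfolding average_def by (rule divide_right_mono_ennreal)
  then show ?thesis
    using emeasure_cube_neq[OF Q] by (simp add: ennreal_mult_divide_eq)
qed

text \<open>Boundedness of \<open>M\<close> on \<open>s = q (1 - \<theta>)\<close> gives the \<open>A\<close>-type condition for \<open>q\<close> without duality:
  on \<open>Q\<close> the maximal function dominates the constant average.\<close>

lemma average_mult_Lvar_norm_indicator:
  fixes q :: "real^'n \<Rightarrow> real"
  assumes s: "(\<lambda>x. q x * (1 - \<theta>)) \<in> maximal_exponents"
    and [measurable]: "q \<in> borel_measurable lebesgue"
    and q: "\<And>x. 1 \<le> q x" and \<theta>: "0 < \<theta>" "\<theta> < 1"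
  shows "\<exists>C>0. \<forall>Q\<in>cubes. \<forall>g\<in>borel_measurable lebesgue. \<forall>r>0.
    modular q (\<lambda>x. g x * indicator Q x / r) \<le> 1 \<longrightarrow>
    average g Q * Lvar_norm q (indicator Q) \<le> ennreal (C * r)"
proof -
  define s where "s x = q x * (1 - \<theta>)" for x
  have s: "s \<in> maximal_exponents" using assms(1) by (simp add: s_def[abs_def])
  note s_facts = maximal_exponentsD[OF s]
  have s0: "0 \<le> s x" for x using s_facts(2)[of x] by simp
  obtain C1 where C1: "0 < C1"
    and Mfin: "\<forall>f\<in>Lvar s. AE x in lebesgue. \<bar>enn2ereal (maximal f x)\<bar> \<noteq> \<infinity>"
    and Mbound: "\<forall>f\<in>borel_measurable lebesgue. \<forall>r>0. modular s (\<lambda>x. f x / r) \<le> 1 \<longrightarrow>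
      modular s (\<lambda>x. real_of_ereal (enn2ereal (maximal f x)) / (C1 * r)) \<le> 1"
    using bounded_operator_modular[OF s0 s_facts(3)] by (elim exE conjE) (rule that)
  have "average g Q * Lvar_norm q (indicator Q) \<le> ennreal (C1 powr (1 - \<theta>) * r)"
    if Q: "Q \<in> cubes" and [measurable]: "g \<in> borel_measurable lebesgue" and r: "0 < r"
      and mod: "modular q (\<lambda>x. g x * indicator Q x / r) \<le> 1" for Q g r
  proof -
    define \<mu> where "\<mu> = measure lebesgue Q"
    have \<mu>: "0 < \<mu>" unfolding \<mu>_def by (rule measure_cube_pos[OF Q])
    have [measurable]: "Q \<in> sets lebesgue" using Q by (rule sets_cube)
    \<comment> \<open>The power 1/(1 - \<theta>) turns the q-modular of g \<chi>_Q / r into the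
      s-modular of \<open>h\<close>.\<close>
    define h where "h x = \<bar>g x * indicator Q x / r\<bar> powr (1 / (1 - \<theta>))" for x
    have [measurable]: "h \<in> borel_measurable lebesgue" unfolding h_def by measurable
    have "modular s (\<lambda>x. h x / 1) = modular q (\<lambda>x. g x * indicator Q x / r)"
      using \<theta> by (simp add: modular_def h_def powr_powr s_def)
    with mod have hs: "modular s (\<lambda>x. h x / 1) \<le> 1" by simp
    let ?M = "\<lambda>x. real_of_ereal (enn2ereal (maximal h x))"
    have "h \<in> Lvar s" using hs by (rule Lvar_modularI[rotated 2]) auto
    then have Mh: "AE x in lebesgue. \<bar>enn2ereal (maximal h x)\<bar> \<noteq> \<infinity>" by (rule Mfin[rule_format])
    have Mh1: "modular s (\<lambda>x. ?M x / C1) \<le> 1"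
      using Mbound[rule_format, OF _ _ hs] by simp
    \<comment> \<open>An infinite average would make M h infinite on all of Q, a set of positive
      measure.\<close>
    have "average h Q \<noteq> \<infinity>"
    proof
      assume inf: "average h Q = \<infinity>"
      have "AE x in lebesgue. x \<notin> Q"
        using Mh
      proof eventually_elim
        case (elim x)
        show ?case
        proof
          assume "x \<in> Q"
          with average_le_maximal[OF Q this, of h] inf have "maximal h x = \<infinity>" by (simp add: top_unique)
          with elim show False by simp
        qed
      qed
      then have "emeasure lebesgue Q = 0"
        by (subst (asm) AE_iff_measurable[where N = Q]) (auto simp: sets_cube[OF Q])
      with emeasure_cube_neq[OF Q] show False by simp
    qed
    then obtain m where m: "average h Q = ennreal m" "0 \<le> m" by (cases "average h Q") auto
    \<comment> \<open>Jensen's inequality for the concave power 1 - \<theta>, obtained from Hoelder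
      with \<chi>_Q as second factor.\<close>
    have "average g Q \<le> ennreal (r * m powr (1 - \<theta>))"
    proof -
      have "(\<integral>\<^sup>+x\<in>Q. ennreal \<bar>g x\<bar> \<partial>lebesgue) = (\<integral>\<^sup>+x. ennreal r * ennreal (h x powr (1 - \<theta>) * indicator Q x powr \<theta>) \<partial>lebesgue)"
      proof (rule nn_integral_cong)
        fix x
        show "ennreal \<bar>g x\<bar> * indicator Q x = ennreal r * ennreal (h x powr (1 - \<theta>) * indicator Q x powr \<theta>)"
          using r \<theta> by (auto simp: h_def powr_powr indicator_def ennreal_mult[symmetric])
      qed
      also have "\<dots> = ennreal r * (\<integral>\<^sup>+x. ennreal (h x powr (1 - \<theta>) * indicator Q x powr \<theta>) \<partial>lebesgue)"
        by (rule nn_integral_cmult) simp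
      also have "\<dots> \<le> ennreal r * ennreal ((m * \<mu>) powr (1 - \<theta>) * \<mu> powr \<theta>)"
      proof (intro mult_left_mono nn_integral_Holder_bound)
        have "(\<integral>\<^sup>+x. ennreal (h x) \<partial>lebesgue) = (\<integral>\<^sup>+x\<in>Q. ennreal \<bar>h x\<bar> \<partial>lebesgue)"
          by (intro nn_integral_cong) (auto simp: h_def indicator_def)
        also have "\<dots> \<le> ennreal (m * \<mu>)"
          using average_le_iff[OF Q m(2), of h] m by (simp add: \<mu>_def)
        finally show "(\<integral>\<^sup>+x. ennreal (h x) \<partial>lebesgue) \<le> ennreal (m * \<mu>)" .
        show "(\<integral>\<^sup>+x. ennreal (indicator Q x) \<partial>lebesgue) \<le> ennreal \<mu>"
          using emeasure_cube[OF Q] by (simp add: \<mu>_def ennreal_indicator del: emeasure_completion)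
      qed (use m \<mu> \<theta> in \<open>auto simp: h_def\<close>)
      also have "\<dots> = ennreal (r * m powr (1 - \<theta>) * \<mu>)"
      proof -
        have "\<mu> powr (1 - \<theta>) * \<mu> powr \<theta> = \<mu>" using \<mu> by (simp add: powr_add[symmetric])
        then have "r * ((m * \<mu>) powr (1 - \<theta>) * \<mu> powr \<theta>) = r * m powr (1 - \<theta>) * \<mu>"
          using m \<mu> by (simp add: powr_mult mult.assoc)
        then show ?thesis using r m \<mu> by (subst ennreal_mult[symmetric]) (auto simp: mult.assoc)
      qed
      finally show ?thesis using r by (subst average_le_iff[OF Q]) (auto simp: \<mu>_def)
    qed
    then have "average g Q * Lvar_norm q (indicator Q)
        \<le> ennreal (r * m powr (1 - \<theta>)) * Lvar_norm q (indicator Q)"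
      by (rule mult_right_mono) simp
    also have "\<dots> \<le> ennreal (C1 powr (1 - \<theta>) * r)"
    proof (cases "m = 0")
      case True
      then show ?thesis by simp
    next
      case False
      with m have m0: "0 < m" by simp
      \<comment> \<open>Defined by (1/\<rho>)^q = (m/C1)^s. As M h >= m on Q, the modular bound for
        M h / C1 makes \<rho> admissible for \<chi>_Q, and the powers of m cancel in the
        product.\<close>
      define \<rho> where "\<rho> = (C1 / m) powr (1 - \<theta>)"
      have \<rho>: "0 < \<rho>" using C1 m0 by (simp add: \<rho>_def)
      have "modular q (\<lambda>x. indicator Q x / \<rho>) \<le> modular s (\<lambda>x. ?M x / C1)"
        unfolding modular_def
      proof (rule nn_integral_mono_AE)
        show "AE x in lebesgue. ennreal (\<bar>indicator Q x / \<rho>\<bar> powr q x) \<le> ennreal (\<bar>?M x / C1\<bar> powr s x)"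
          using Mh
        proof eventually_elim
          case (elim x)
          show ?case
          proof (cases "x \<in> Q")
            case True
            obtain u where u: "maximal h x = ennreal u" "0 \<le> u"
              using elim by (cases "maximal h x") auto
            have "ennreal m \<le> ennreal u"
              using average_le_maximal[OF Q True, of h] m u by simp
            then have "m \<le> u" using u by simp
            have "(1 / \<rho>) powr q x = (m / C1) powr s x"
              using m0 C1 by (simp add: \<rho>_def s_def powr_powr powr_divide mult.commute)
            also have "\<dots> \<le> (u / C1) powr s x"
              using s0[of x] \<open>m \<le> u\<close> C1 m0 by (intro powr_mono2 divide_right_mono) auto
            finally show ?thesis
              using True u C1 \<rho> by (auto simp: enn2ereal_ennreal intro!: ennreal_leI)
          qed simp
        qed
      qed
      with Mh1 have "modular q (\<lambda>x. indicator Q x / \<rho>) \<le> 1" by simp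
      then have "Lvar_norm q (indicator Q) \<le> ennreal \<rho>"
        using \<rho> by (intro Lvar_normI) auto
      then have "ennreal (r * m powr (1 - \<theta>)) * Lvar_norm q (indicator Q)
          \<le> ennreal (r * m powr (1 - \<theta>)) * ennreal \<rho>"
        by (rule mult_left_mono) simp
      also have "\<dots> = ennreal (C1 powr (1 - \<theta>) * r)"
      proof -
        have "r * m powr (1 - \<theta>) * \<rho> = C1 powr (1 - \<theta>) * r"
          using m0 C1 by (simp add: \<rho>_def powr_divide)
        then show ?thesis using r \<rho> by (subst ennreal_mult[symmetric]) auto
      qed
      finally show ?thesis .
    qed
    finally show ?thesis .
  qed
  with C1 show ?thesis by (intro exI[of _ "C1 powr (1 - \<theta>)"]) auto
qed

text \<open>The oscillation condition says that g = b - M_Q b has norm at most K |Q|^\<theta> times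
  that of \<chi>_Q. Feeding this into \<open>average_mult_Lvar_norm_indicator\<close> cancels the
  norm of \<chi>_Q, so the variable exponent disappears from the estimate. K + 1 replaces K to have
  a strict inequality for \<open>Lvar_norm_less\<close>.\<close>

lemma average_oscillation_bound:
  fixes b p q :: "real^'n \<Rightarrow> real"
  assumes b: "locally_integrable b" and \<beta>: "0 < \<beta>" "\<beta> < 1"
    and pq: "(p, q) \<in> exponent_pairs \<beta>" and osc: "oscillation \<beta> q b < \<infinity>"
  shows "\<exists>C\<ge>0. \<forall>Q\<in>cubes. average (\<lambda>x. b x - enn2real (local_maximal Q b x)) Q
    \<le> ennreal (C * measure lebesgue Q powr (\<beta> / real CARD('n)))"
proof -
  define \<theta> where "\<theta> = \<beta> / real CARD('n)"
  note pq_facts = exponent_pairsD[OF pq \<beta>(2) \<theta>_def]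
  note [measurable] = pq_facts(3,4) locally_integrable_measurable[OF b]
  have q0: "0 \<le> q x" for x using pq_facts(6)[of x] by simp
  obtain C where C: "0 < C" and avg: "\<forall>Q\<in>cubes. \<forall>g\<in>borel_measurable lebesgue. \<forall>r>0.
    modular q (\<lambda>x. g x * indicator Q x / r) \<le> 1 \<longrightarrow>
    average g Q * Lvar_norm q (indicator Q) \<le> ennreal (C * r)"
    using average_mult_Lvar_norm_indicator[OF pq_facts(7,4,6,1,2)] by (elim exE conjE) (rule that)
  obtain K where K: "oscillation \<beta> q b = ennreal K" "0 \<le> K"
    using osc by (cases "oscillation \<beta> q b") auto
  have "average (\<lambda>x. b x - enn2real (local_maximal Q b x)) Q \<le> ennreal (C * (K + 1) * measure lebesgue Q powr \<theta>)"
    if Q: "Q \<in> cubes" for Q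
  proof -
    define \<mu> where "\<mu> = measure lebesgue Q"
    have \<mu>: "0 < \<mu>" unfolding \<mu>_def by (rule measure_cube_pos[OF Q])
    define g where "g x = b x - enn2real (local_maximal Q b x)" for x
    note borel_measurable_maximal_lebesgue[measurable]
    have [measurable]: "g \<in> borel_measurable lebesgue" unfolding g_def by measurable
    define X where "X = Lvar_norm q (\<lambda>x. g x * indicator Q x)"
    have "Lvar_norm q (indicator Q) \<noteq> \<infinity>"
    proof -
      obtain r where "0 < r" "modular q (\<lambda>x. indicator Q x / r) \<le> 1"
        using Lvar_modular_le_1[OF pq_facts(4,6) indicator_cube_in_Lvar[OF Q pq_facts(6)]] by blast
      then have "Lvar_norm q (indicator Q) \<le> ennreal r"
        using sets_cube[OF Q] by (intro Lvar_normI) auto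
      then show ?thesis by (auto simp: top_unique)
    qed
    moreover have "0 < Lvar_norm q (indicator Q)"
      by (rule Lvar_norm_indicator_pos[OF Q pq_facts(6)])
    ultimately obtain \<nu> where \<nu>: "Lvar_norm q (indicator Q) = ennreal \<nu>" "0 < \<nu>"
      by (cases "Lvar_norm q (indicator Q)") auto
    have "ennreal (1 / \<mu> powr \<theta>) * (X / ennreal \<nu>) \<le> ennreal K"
      unfolding K(1)[symmetric] oscillation_def X_def \<nu>(1)[symmetric] g_def \<mu>_def \<theta>_def
      by (rule SUP_upper[OF Q])
    then have "ennreal (\<mu> powr \<theta> * \<nu>) * (ennreal (1 / \<mu> powr \<theta>) * (X / ennreal \<nu>)) \<le> ennreal (\<mu> powr \<theta> * \<nu>) * ennreal K"
      by (rule mult_left_mono) simp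
    moreover have "ennreal (\<mu> powr \<theta> * \<nu>) * (ennreal (1 / \<mu> powr \<theta>) * (X / ennreal \<nu>)) = X"
    proof -
      have "ennreal (\<mu> powr \<theta> * \<nu>) * ennreal (1 / \<mu> powr \<theta>) = ennreal \<nu>"
        using \<mu> \<nu> by (subst ennreal_mult[symmetric]) auto
      then have "ennreal (\<mu> powr \<theta> * \<nu>) * (ennreal (1 / \<mu> powr \<theta>) * (X / ennreal \<nu>)) = X / ennreal \<nu> * ennreal \<nu>"
        by (simp only: mult.assoc[symmetric]) (simp only: mult.commute)
      also have "\<dots> = X"
        using \<nu> by (simp add: ennreal_divide_times ennreal_times_divide ennreal_mult_divide_eq)
      finally show ?thesis .
    qed
    ultimately have "X \<le> ennreal (\<mu> powr \<theta> * \<nu>) * ennreal K" by simp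
    also have "\<dots> = ennreal (K * \<mu> powr \<theta> * \<nu>)"
      using \<mu> \<nu> K by (subst ennreal_mult[symmetric]) (auto simp: mult_ac)
    also have "\<dots> < ennreal ((K + 1) * \<mu> powr \<theta> * \<nu>)"
      using \<mu> \<nu> K by (intro ennreal_lessI) (auto simp: add_nonneg_pos)
    finally have "modular q (\<lambda>x. g x * indicator Q x / ((K + 1) * \<mu> powr \<theta> * \<nu>)) \<le> 1"
      unfolding X_def by (rule Lvar_norm_less[OF q0])
    then have "average g Q * ennreal \<nu> \<le> ennreal (C * ((K + 1) * \<mu> powr \<theta> * \<nu>))"
      unfolding \<nu>(1)[symmetric] using Q \<mu> \<nu>(2) K by (intro avg[rule_format]) auto
    also have "\<dots> = ennreal (C * (K + 1) * \<mu> powr \<theta>) * ennreal \<nu>"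
      using C K \<nu> by (subst ennreal_mult[symmetric]) (auto simp: mult_ac)
    finally have "ennreal \<nu> * average g Q \<le> ennreal \<nu> * ennreal (C * (K + 1) * \<mu> powr \<theta>)"
      by (simp only: mult.commute)
    then show ?thesis
      using \<nu> by (subst (asm) ennreal_mult_le_mult_iff) (auto simp: g_def[abs_def] \<mu>_def)
  qed
  then show ?thesis
    using C K unfolding \<theta>_def[symmetric] by (intro exI[of _ "C * (K + 1)"]) auto
qed

section \<open>Mean oscillation and Lebesgue differentiation\<close>

text \<open>Keeps the sign of b, in contrast to \<open>average\<close>, which integrates the
  absolute value.\<close>

definition mean :: "(real^'n \<Rightarrow> real) \<Rightarrow> (real^'n) set \<Rightarrow> real" where
  "mean b Q = (LINT x:Q|lebesgue. b x) / measure lebesgue Q"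

lemma set_integrable_const_cube:
  assumes "Q \<in> cubes"
  shows "set_integrable lebesgue Q (\<lambda>x. c::real)"
  using lmeasurable_cube[OF assms]
  by (auto simp: set_integrable_def fmeasurable_def intro!: integrable_real_indicator)

lemma set_integral_const_cube:
  assumes "Q \<in> cubes"
  shows "(LINT x:Q|lebesgue. c::real) = c * measure lebesgue Q"
  by (simp add: set_lebesgue_integral_def)

text \<open>With m the mean, u = (b - m) \<chi>_Q has integral zero, so the integral of |u| is twice
  that of its negative part. Almost everywhere on Q one has m <= |m| <= average of |b| <= M_Q b,
  hence the negative part is at most |b - M_Q b|.\<close>

lemma mean_deviation_le:
  fixes b :: "real^'n \<Rightarrow> real"
  assumes b: "locally_integrable b" and Q: "Q \<in> cubes" and C: "0 \<le> C"
    and avg: "average (\<lambda>x. b x - enn2real (local_maximal Q b x)) Q \<le> ennreal C"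
  shows "(LINT x:Q|lebesgue. \<bar>b x - mean b Q\<bar>) \<le> 2 * C * measure lebesgue Q"
proof -
  define \<mu> where "\<mu> = measure lebesgue Q"
  have \<mu>: "0 < \<mu>" unfolding \<mu>_def by (rule measure_cube_pos[OF Q])
  have [measurable]: "Q \<in> sets lebesgue" "b \<in> borel_measurable lebesgue"
    using Q b by (auto intro: sets_cube locally_integrable_measurable)
  define m where "m = mean b Q"
  note bQ = locally_integrable_cube[OF b Q]
  have "ennreal \<bar>LINT x:Q|lebesgue. b x\<bar> \<le> (\<integral>\<^sup>+x. ennreal (norm (indicator Q x *\<^sub>R b x)) \<partial>lebesgue)"
    using bQ unfolding set_integrable_def set_lebesgue_integral_def real_norm_def[symmetric]
    by (rule integral_norm_bound_ennreal)
  also have "\<dots> = (\<integral>\<^sup>+x\<in>Q. ennreal \<bar>b x\<bar> \<partial>lebesgue)"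
    by (intro nn_integral_cong) (auto simp: indicator_def)
  finally have "ennreal (\<bar>m\<bar> * \<mu>) \<le> (\<integral>\<^sup>+x\<in>Q. ennreal \<bar>b x\<bar> \<partial>lebesgue)"
    using \<mu> by (simp add: m_def mean_def \<mu>_def)
  then have "ennreal \<mu> * ennreal \<bar>m\<bar> \<le> ennreal \<mu> * average b Q"
    using \<mu> unfolding average_mult_emeasure[OF Q, symmetric] \<mu>_def[symmetric]
    by (simp add: ennreal_mult mult.commute)
  then have m: "ennreal \<bar>m\<bar> \<le> average b Q"
    using \<mu> by (subst (asm) ennreal_mult_le_mult_iff) auto
  define u where "u x = indicator Q x * (b x - m)" for x
  have u: "integrable lebesgue u"
    using set_integral_diff(1)[OF bQ set_integrable_const_cube[OF Q, of m]]
    by (simp add: set_integrable_def u_def[abs_def])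
  have "integral\<^sup>L lebesgue u = (LINT x:Q|lebesgue. b x) - (LINT x:Q|lebesgue. m)"
    using set_integral_diff(2)[OF bQ set_integrable_const_cube[OF Q, of m]]
    by (simp add: set_lebesgue_integral_def u_def[abs_def])
  also have "\<dots> = 0"
    using \<mu> by (simp add: set_integral_const_cube[OF Q] m_def mean_def \<mu>_def)
  finally have u0: "integral\<^sup>L lebesgue u = 0" .
  have neg: "integrable lebesgue (\<lambda>x. max 0 (- u x))"
    using u by (intro integrable_max) auto
  have "ennreal (\<integral>x. max 0 (- u x) \<partial>lebesgue) = (\<integral>\<^sup>+x. ennreal (max 0 (- u x)) \<partial>lebesgue)"
    by (rule nn_integral_eq_integral[symmetric, OF neg]) auto
  also have "\<dots> \<le> (\<integral>\<^sup>+x\<in>Q. ennreal \<bar>b x - enn2real (local_maximal Q b x)\<bar> \<partial>lebesgue)"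
  proof (rule nn_integral_mono_AE)
    show "AE x in lebesgue. ennreal (max 0 (- u x)) \<le>
        ennreal \<bar>b x - enn2real (local_maximal Q b x)\<bar> * indicator Q x"
      using local_maximal_finite_AE[OF b Q]
    proof eventually_elim
      case (elim x)
      show ?case
      proof (cases "x \<in> Q")
        case True
        then obtain v where v: "local_maximal Q b x = ennreal v" "0 \<le> v"
          using elim by (cases "local_maximal Q b x") auto
        have "average b Q \<le> local_maximal Q b x"
          using Q True by (intro average_le_local_maximal) auto
        with m have "ennreal \<bar>m\<bar> \<le> local_maximal Q b x" by (rule order_trans)
        then have "m \<le> v" using v by simp
        then have "max 0 (- u x) \<le> \<bar>b x - v\<bar>" using True by (simp add: u_def)
        then show ?thesis using True v by (simp add: ennreal_leI)
      qed (simp add: u_def)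
    qed
  qed
  also have "\<dots> \<le> ennreal (C * \<mu>)"
    using avg unfolding average_le_iff[OF Q C] \<mu>_def .
  finally have neg_le: "(\<integral>x. max 0 (- u x) \<partial>lebesgue) \<le> C * \<mu>"
    using C \<mu> by (simp add: ennreal_le_iff)
  have "(LINT x:Q|lebesgue. \<bar>b x - m\<bar>) = (\<integral>x. u x + 2 * max 0 (- u x) \<partial>lebesgue)"
    unfolding set_lebesgue_integral_def
    by (intro Bochner_Integration.integral_cong) (auto simp: u_def indicator_def max_def abs_if)
  also have "\<dots> = 2 * (\<integral>x. max 0 (- u x) \<partial>lebesgue)"
    using u neg by (simp add: u0)
  finally show ?thesis using neg_le by (simp add: m_def \<mu>_def)
qed

text \<open>The difference is the mean of b - \<open>mean b Q\<close> over R; its absolute value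
  grows when the integral of the modulus is extended to Q.\<close>

lemma mean_diff_subcube:
  fixes b :: "real^'n \<Rightarrow> real"
  assumes b: "locally_integrable b" and Q: "Q \<in> cubes" and R: "R \<in> cubes" "R \<subseteq> Q"
    and dev: "(LINT x:Q|lebesgue. \<bar>b x - mean b Q\<bar>) \<le> D"
  shows "\<bar>mean b R - mean b Q\<bar> \<le> D / measure lebesgue R"
proof -
  define \<mu> where "\<mu> = measure lebesgue R"
  have \<mu>: "0 < \<mu>" unfolding \<mu>_def by (rule measure_cube_pos[OF R(1)])
  note bR = locally_integrable_cube[OF b R(1)]
  note bQ = locally_integrable_cube[OF b Q]
  let ?m = "mean b Q"
  have dR: "set_integrable lebesgue R (\<lambda>x. b x - ?m)" and dQ: "set_integrable lebesgue Q (\<lambda>x. b x - ?m)"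
    by (intro set_integral_diff bR bQ set_integrable_const_cube R(1) Q)+
  have aQ: "set_integrable lebesgue Q (\<lambda>x. \<bar>b x - ?m\<bar>)"
    using dQ by (rule set_integrable_abs)
  have aR: "set_integrable lebesgue R (\<lambda>x. \<bar>b x - ?m\<bar>)"
    using dR by (rule set_integrable_abs)
  have "(LINT x:R|lebesgue. b x - ?m) = (LINT x:R|lebesgue. b x) - ?m * \<mu>"
    using set_integral_diff(2)[OF bR set_integrable_const_cube[OF R(1), of ?m]]
    by (simp add: set_integral_const_cube[OF R(1)] \<mu>_def)
  also have "\<dots> = (mean b R - ?m) * \<mu>"
    using \<mu> by (simp add: mean_def[of b R] \<mu>_def left_diff_distrib)
  finally have "\<bar>mean b R - ?m\<bar> * \<mu> = \<bar>LINT x:R|lebesgue. b x - ?m\<bar>"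
    using \<mu> by (simp add: abs_mult)
  also have "\<dots> \<le> (LINT x:R|lebesgue. \<bar>b x - ?m\<bar>)"
    using set_integral_norm_bound[OF dR] by simp
  also have "\<dots> \<le> (LINT x:Q|lebesgue. \<bar>b x - ?m\<bar>)"
    using aQ aR R(2) unfolding set_lebesgue_integral_def set_integrable_def
    by (intro integral_mono) (auto simp: indicator_def)
  also have "\<dots> \<le> D" by (rule dev)
  finally show ?thesis using \<mu> by (simp add: \<mu>_def field_simps)
qed

lemma scaleR_One_eq_vec: "h *\<^sub>R One = (vec h :: real^'n)"
proof -
  have "(One :: real^'n) $ i = 1" for i
    by (simp add: cart_eq_inner_axis inner_sum_left_Basis axis_in_Basis_iff)
  then show ?thesis by (simp add: vec_eq_iff)
qed

text \<open>Lebesgue differentiation along cubes with x as lower corner, the family of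
  \<open>integrable_ccontinuous_explicit\<close>. The telescoping argument for Campanato's theorem
  uses the same cubes.\<close>

lemma mean_corner_cube_tendsto:
  fixes b :: "real^'n \<Rightarrow> real"
  assumes b: "locally_integrable b"
  shows "\<exists>N. negligible N \<and> (\<forall>x. x \<notin> N \<longrightarrow> ((\<lambda>h. mean b (box x (x + vec h))) \<longlongrightarrow> b x) (at_right 0))"
proof -
  have "set_integrable lebesgue (cbox c d) b" for c d
    using b compact_cbox by (auto simp: locally_integrable_def)
  then have int: "b integrable_on cbox c d" for c d
    by (rule set_lebesgue_integral_eq_integral(1))
  obtain N where N: "negligible N" and lim: "\<forall>x e. x \<notin> N \<longrightarrow> 0 < e \<longrightarrow>
      (\<exists>d>0. \<forall>h. 0 < h \<and> h < d \<longrightarrow> norm (integral (cbox x (x + h *\<^sub>R One)) b /\<^sub>R h ^ DIM(real^'n) - b x) < e)"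
    using integrable_ccontinuous_explicit[OF int] by metis
  have mean: "mean b (box x (x + vec h)) = integral (cbox x (x + h *\<^sub>R One)) b /\<^sub>R h ^ DIM(real^'n)"
    if h: "0 < h" for x h
  proof -
    have "(LINT y:box x (x + vec h)|lebesgue. b y) = integral (box x (x + vec h)) b"
      using locally_integrable_cube[OF b box_vec_in_cubes[OF h]]
      by (rule set_lebesgue_integral_eq_integral(2))
    moreover have "measure lebesgue (box x (x + vec h)) = h ^ CARD('n)"
      using h by (intro measure_box_vec) auto
    ultimately show ?thesis
      unfolding mean_def by (simp only: scaleR_One_eq_vec integral_open_interval) (simp add: divide_inverse mult.commute)
  qed
  have "((\<lambda>h. mean b (box x (x + vec h))) \<longlongrightarrow> b x) (at_right 0)" if "x \<notin> N" for x
    unfolding tendsto_iff dist_norm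
  proof (intro allI impI)
    fix e :: real assume "0 < e"
    with lim that obtain d where d: "d > 0" "\<forall>h. 0 < h \<and> h < d \<longrightarrow>
        norm (integral (cbox x (x + h *\<^sub>R One)) b /\<^sub>R h ^ DIM(real^'n) - b x) < e" by blast
    then show "\<forall>\<^sub>F h in at_right 0. norm (mean b (box x (x + vec h)) - b x) < e"
      unfolding eventually_at_right_field using mean by (intro exI[of _ d]) auto
  qed
  with N show ?thesis by blast
qed

section \<open>Hoelder extension and Campanato's theorem\<close>

text \<open>For t in [0, 1], t <= t^\<beta>; apply this to a/(a + b) and b/(a + b), which sum to
  1.\<close>

lemma powr_add_le:
  fixes a b :: real
  assumes "0 \<le> a" "0 \<le> b" "0 < \<beta>" "\<beta> \<le> 1"
  shows "(a + b) powr \<beta> \<le> a powr \<beta> + b powr \<beta>"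
proof (cases "a + b = 0")
  case False
  with assms have ab: "0 < a + b" by simp
  have le: "c / (a + b) \<le> (c / (a + b)) powr \<beta>" if "0 \<le> c" "c \<le> a + b" for c
  proof (cases "c = 0")
    case False
    with that ab have "0 < c / (a + b)" "c / (a + b) \<le> 1" by auto
    then have "(c / (a + b)) powr 1 \<le> (c / (a + b)) powr \<beta>"
      using assms by (intro powr_mono') auto
    then show ?thesis
      by (simp only: powr_one[OF less_imp_le[OF \<open>0 < c / (a + b)\<close>]])
  qed simp
  have "1 = a / (a + b) + b / (a + b)" using ab by (simp add: add_divide_distrib[symmetric])
  also have "\<dots> \<le> (a / (a + b)) powr \<beta> + (b / (a + b)) powr \<beta>"
    using assms by (intro add_mono le) auto
  also have "\<dots> = (a powr \<beta> + b powr \<beta>) / (a + b) powr \<beta>"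
    using assms ab by (simp add: powr_divide add_divide_distrib)
  finally show ?thesis using ab by (simp add: field_simps)
qed (use assms in auto)

text \<open>McShane's extension: by \<open>powr_add_le\<close>, |x - y|^\<beta> satisfies the
  triangle inequality, so the infimum of f(y) + K |x - y|^\<beta> over T works as for Lipschitz
  functions and keeps the constant.\<close>

lemma Hoelder_extension:
  fixes f :: "'a::real_normed_vector \<Rightarrow> real"
  assumes T: "T \<noteq> {}" and K: "0 \<le> K" and \<beta>: "0 < \<beta>" "\<beta> \<le> 1"
    and f: "\<And>x y. x \<in> T \<Longrightarrow> y \<in> T \<Longrightarrow> \<bar>f x - f y\<bar> \<le> K * norm (x - y) powr \<beta>"
  shows "\<exists>g. (\<forall>x\<in>T. g x = f x) \<and> (\<forall>x y. \<bar>g x - g y\<bar> \<le> K * norm (x - y) powr \<beta>)"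
proof -
  have tri: "K * norm (x - z) powr \<beta> \<le> K * norm (x - y) powr \<beta> + K * norm (y - z) powr \<beta>" for x y z :: 'a
  proof -
    have "norm (x - z) powr \<beta> \<le> (norm (x - y) + norm (y - z)) powr \<beta>"
      using \<beta> norm_triangle_ineq[of "x - y" "y - z"] by (intro powr_mono2) auto
    also have "\<dots> \<le> norm (x - y) powr \<beta> + norm (y - z) powr \<beta>"
      using \<beta> by (intro powr_add_le) auto
    finally show ?thesis using K by (simp add: distrib_left[symmetric] mult_left_mono)
  qed
  define g where "g x = (INF y\<in>T. f y + K * norm (x - y) powr \<beta>)" for x
  obtain z where z: "z \<in> T" using T by blast
  have bdd: "bdd_below ((\<lambda>y. f y + K * norm (x - y) powr \<beta>) ` T)" for x
  proof (rule bdd_belowI2)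
    fix y assume "y \<in> T"
    have "f z - f y \<le> K * norm (z - y) powr \<beta>" using f[OF z \<open>y \<in> T\<close>] by simp
    with tri[of z y x] show "f z - K * norm (z - x) powr \<beta> \<le> f y + K * norm (x - y) powr \<beta>" by simp
  qed
  have "g x = f x" if x: "x \<in> T" for x
  proof (rule antisym)
    have "g x \<le> f x + K * norm (x - x) powr \<beta>"
      unfolding g_def by (rule cINF_lower[OF bdd x])
    then show "g x \<le> f x" using \<beta> by simp
    show "f x \<le> g x"
      unfolding g_def
    proof (rule cINF_greatest[OF T])
      fix y assume "y \<in> T"
      then show "f x \<le> f y + K * norm (x - y) powr \<beta>" using f[OF x \<open>y \<in> T\<close>] by simp
    qed
  qed
  moreover have le: "g x \<le> g y + K * norm (x - y) powr \<beta>" for x y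
  proof -
    have "g x - K * norm (x - y) powr \<beta> \<le> g y"
      unfolding g_def[of y]
    proof (rule cINF_greatest[OF T])
      fix w assume w: "w \<in> T"
      have "g x \<le> f w + K * norm (x - w) powr \<beta>"
        unfolding g_def by (rule cINF_lower[OF bdd w])
      with tri[of x w y] show "g x - K * norm (x - y) powr \<beta> \<le> f w + K * norm (y - w) powr \<beta>" by simp
    qed
    then show ?thesis by simp
  qed
  moreover have "\<bar>g x - g y\<bar> \<le> K * norm (x - y) powr \<beta>" for x y
    using le[of x y] le[of y x] by (simp add: norm_minus_commute)
  ultimately show ?thesis by blast
qed

text \<open>Campanato's theorem. Means over successively halved corner cubes differ by terms of a
  geometric series, so b(x) is within a multiple of h^\<beta> of its mean over the cube of side h at
  x. Two points at distance h are compared through a common cube of side 2h.\<close>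

lemma Lipschitz_space_if_mean_deviation:
  fixes b :: "real^'n \<Rightarrow> real"
  assumes b: "locally_integrable b" and \<beta>: "0 < \<beta>" "\<beta> \<le> 1" and K: "0 \<le> K"
    and dev: "\<And>Q. Q \<in> cubes \<Longrightarrow> (LINT x:Q|lebesgue. \<bar>b x - mean b Q\<bar>)
      \<le> K * measure lebesgue Q powr (\<beta> / real CARD('n)) * measure lebesgue Q"
  shows "b \<in> Lipschitz_space \<beta>"
proof -
  define n where "n = CARD('n)"
  have n: "0 < n" by (simp add: n_def)
  define Qc where "Qc x h = box x (x + vec h)" for x :: "real^'n" and h :: real
  have Qc: "Qc x h \<in> cubes" if "0 < h" for x h using that by (simp add: Qc_def box_vec_in_cubes)
  have mQc: "measure lebesgue (Qc x h) = h ^ n" if "0 < h" for x h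
    unfolding Qc_def n_def using that by (intro measure_box_vec) auto
  have half: "\<bar>mean b (Qc y h) - mean b (Qc x (2 * h))\<bar> \<le> K * 2 ^ n * (2 * h) powr \<beta>"
    if h: "0 < h" and sub: "Qc y h \<subseteq> Qc x (2 * h)" for x y h
  proof -
    have "\<bar>mean b (Qc y h) - mean b (Qc x (2 * h))\<bar>
        \<le> K * measure lebesgue (Qc x (2 * h)) powr (\<beta> / real CARD('n)) * measure lebesgue (Qc x (2 * h)) / measure lebesgue (Qc y h)"
      using h by (intro mean_diff_subcube b Qc sub dev) auto
    also have "\<dots> = K * ((2 * h) ^ n) powr (\<beta> / n) * (2 * h) ^ n / h ^ n"
      using h by (simp add: mQc n_def)
    also have "((2 * h) ^ n) powr (\<beta> / n) = (2 * h) powr \<beta>"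
      using h n by (subst powr_realpow[symmetric]) (auto simp: powr_powr)
    finally show ?thesis using h by (simp add: power_mult_distrib mult_ac)
  qed
  define \<rho> where "\<rho> = (1 / 2 :: real) powr \<beta>"
  have \<rho>: "0 < \<rho>" "\<rho> < 1"
    using \<beta> powr_less_mono2[of \<beta> "1/2" 1] by (auto simp: \<rho>_def)
  \<comment> \<open>The sum of the geometric series of halving errors: each halving costs the volume
    ratio \<open>2 ^ n\<close> and multiplies the scale factor by \<rho>.\<close>
  define K1 where "K1 = K * 2 ^ n / (1 - \<rho>)"
  have K1: "0 \<le> K1" using K \<rho> by (simp add: K1_def)
  \<comment> \<open>The factor 1 - \<rho>^k is the partial sum of that series, which lets the
    induction close.\<close>
  have tele: "\<bar>mean b (Qc x (h * (1/2) ^ k)) - mean b (Qc x h)\<bar> \<le> K1 * h powr \<beta> * (1 - \<rho> ^ k)"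
    if h: "0 < h" for x h k
  proof (induction k)
    case (Suc k)
    let ?h = "h * (1/2) ^ Suc k"
    have h': "0 < ?h" using h by simp
    have sub: "Qc x ?h \<subseteq> Qc x (2 * ?h)"
    proof
      fix w assume "w \<in> Qc x ?h"
      moreover have "x $ i + ?h \<le> x $ i + 2 * ?h" for i using h' by simp
      ultimately show "w \<in> Qc x (2 * ?h)"
        unfolding Qc_def mem_box_cart vector_add_component vec_component
        by (blast intro: order.strict_trans2)
    qed
    have e: "2 * ?h = h * (1/2) ^ k" by simp
    have "\<bar>mean b (Qc x ?h) - mean b (Qc x (h * (1/2) ^ k))\<bar> \<le> K * 2 ^ n * (h * (1/2) ^ k) powr \<beta>"
      using half[OF h' sub] unfolding e .
    also have "(h * (1/2) ^ k) powr \<beta> = h powr \<beta> * \<rho> ^ k"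
      using h by (simp add: powr_mult \<rho>_def powr_power powr_powr powr_realpow[symmetric] mult.commute)
    also have "K * 2 ^ n * (h powr \<beta> * \<rho> ^ k) = K1 * h powr \<beta> * (\<rho> ^ k - \<rho> ^ Suc k)"
      using \<rho> by (simp add: K1_def field_simps)
    finally have "\<bar>mean b (Qc x ?h) - mean b (Qc x (h * (1/2) ^ k))\<bar> \<le> K1 * h powr \<beta> * (\<rho> ^ k - \<rho> ^ Suc k)" .
    with Suc have "\<bar>mean b (Qc x ?h) - mean b (Qc x h)\<bar>
        \<le> K1 * h powr \<beta> * (\<rho> ^ k - \<rho> ^ Suc k) + K1 * h powr \<beta> * (1 - \<rho> ^ k)" by linarith
    then show ?case by (simp add: algebra_simps)
  qed simp
  obtain N where N: "negligible N"
    and lim: "\<forall>x. x \<notin> N \<longrightarrow> ((\<lambda>h. mean b (Qc x h)) \<longlongrightarrow> b x) (at_right 0)"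
    using mean_corner_cube_tendsto[OF b] unfolding Qc_def by blast
  have point: "\<bar>b x - mean b (Qc x h)\<bar> \<le> K1 * h powr \<beta>" if x: "x \<notin> N" and h: "0 < h" for x h
  proof -
    have "(\<lambda>k. h * (1/2) ^ k) \<longlonglongrightarrow> h * 0"
      by (intro tendsto_mult LIMSEQ_power_zero tendsto_const) auto
    then have "filterlim (\<lambda>k. h * (1/2) ^ k) (at_right 0) sequentially"
      using h by (simp add: filterlim_at)
    from filterlim_compose[OF lim[rule_format, OF x] this]
    have "(\<lambda>k. mean b (Qc x (h * (1/2) ^ k))) \<longlonglongrightarrow> b x" .
    then have "(\<lambda>k. \<bar>mean b (Qc x (h * (1/2) ^ k)) - mean b (Qc x h)\<bar>) \<longlonglongrightarrow> \<bar>b x - mean b (Qc x h)\<bar>"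
      by (intro tendsto_intros)
    moreover have "\<bar>mean b (Qc x (h * (1/2) ^ k)) - mean b (Qc x h)\<bar> \<le> K1 * h powr \<beta>" for k
    proof (rule order_trans[OF tele[OF h]])
      show "K1 * h powr \<beta> * (1 - \<rho> ^ k) \<le> K1 * h powr \<beta>"
        using K1 \<rho> by (intro mult_left_le) auto
    qed
    ultimately show ?thesis by (intro LIMSEQ_le_const2) auto
  qed
  \<comment> \<open>Twice the distance from a point value to its mean at scale h, plus twice the
    passage from a cube of side h to the common cube of side 2h.\<close>
  define K2 where "K2 = 2 * K1 + 2 * (K * 2 ^ n * 2 powr \<beta>)"
  have K2: "0 \<le> K2" using K K1 by (simp add: K2_def)
  have "\<bar>b x - b y\<bar> \<le> K2 * norm (x - y) powr \<beta>" if xy: "x \<in> - N" "y \<in> - N" for x y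
  proof (cases "x = y")
    case False
    define h where "h = norm (x - y)"
    have h: "0 < h" using False by (simp add: h_def)
    \<comment> \<open>The lower corner of the common cube: |x_i - y_i| <= h puts both corner cubes
      of side h inside the one of side 2h at c.\<close>
    define c where "c = (\<chi> i. min (x $ i) (y $ i))"
    have comp: "\<bar>x $ i - y $ i\<bar> \<le> h" for i
      using component_le_norm_cart[of "x - y" i] by (simp add: h_def)
    have sub: "Qc x h \<subseteq> Qc c (2 * h)" "Qc y h \<subseteq> Qc c (2 * h)"
    proof -
      have *: "c $ i < w \<and> w < c $ i + 2 * h" if "x $ i < w \<and> w < x $ i + h \<or> y $ i < w \<and> w < y $ i + h" for i w
        using that comp[of i] unfolding c_def by (auto simp: min_def abs_le_iff)
      show "Qc x h \<subseteq> Qc c (2 * h)" "Qc y h \<subseteq> Qc c (2 * h)"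
        unfolding Qc_def using * by (auto simp: mem_box_cart)
    qed
    have "\<bar>b x - b y\<bar> \<le> 2 * (K1 * h powr \<beta>) + 2 * (K * 2 ^ n * (2 * h) powr \<beta>)"
      using half[OF h sub(1)] half[OF h sub(2)] point[OF _ h, of x] point[OF _ h, of y] xy by auto
    also have "\<dots> = K2 * h powr \<beta>"
      using h by (simp add: K2_def powr_mult algebra_simps)
    finally show ?thesis by (simp add: h_def)
  qed (use K2 in simp)
  moreover have "- N \<noteq> {}" using N non_negligible_UNIV by (metis Compl_empty_eq double_compl)
  ultimately obtain g where g: "\<forall>x\<in>- N. g x = b x" "\<forall>x y. \<bar>g x - g y\<bar> \<le> K2 * norm (x - y) powr \<beta>"
    using Hoelder_extension[OF _ K2 \<beta>, of "- N" b] by blast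
  have "{x \<in> space lebesgue. b x \<noteq> g x} \<subseteq> N" using g(1) by force
  then have "AE x in lebesgue. b x = g x"
    using N by (intro AE_I'[of N]) (simp_all add: negligible_iff_null_sets)
  with g(2) show ?thesis unfolding Lipschitz_space_def by blast
qed

section \<open>Nonnegativity of b\<close>

text \<open>If the Hoelder representative equals -2\<delta> < 0 at x, then b <= -\<delta> almost
  everywhere on a small cube Q around x. There M_Q b >= \<delta>, because it averages |b|, so |b -
  M_Q b| >= 2\<delta>, while the hypothesis lets its average tend to 0 with Q.\<close>

lemma nonneg_if_average_oscillation:
  fixes b :: "real^'n \<Rightarrow> real"
  assumes b: "locally_integrable b" and \<beta>: "0 < \<beta>" and lip: "b \<in> Lipschitz_space \<beta>" and C: "0 \<le> C"
    and avg: "\<And>Q. Q \<in> cubes \<Longrightarrow> average (\<lambda>x. b x - enn2real (local_maximal Q b x)) Q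
      \<le> ennreal (C * measure lebesgue Q powr (\<beta> / real CARD('n)))"
  shows "AE x in lebesgue. 0 \<le> b x"
proof -
  define n where "n = CARD('n)"
  have n: "0 < n" by (simp add: n_def)
  obtain g L where L: "0 \<le> L" and bg: "AE x in lebesgue. b x = g x"
    and g: "\<forall>x y. \<bar>g x - g y\<bar> \<le> L * norm (x - y) powr \<beta>"
    using Lipschitz_spaceD[OF lip] by (elim exE conjE) (rule that)
  have "0 \<le> g x" for x
  proof (rule ccontr)
    assume "\<not> 0 \<le> g x"
    define \<delta> where "\<delta> = - g x / 2"
    have \<delta>: "0 < \<delta>" using \<open>\<not> 0 \<le> g x\<close> by (simp add: \<delta>_def)
    \<comment> \<open>One side length h with h^\<beta> B = \<delta> meets both demands: L (n
      h)^\<beta> <= \<delta> keeps b below -\<delta> on the cube, and C h^\<beta> <= \<delta>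
      contradicts the lower bound 2\<delta>. The added 1 makes B positive.\<close>
    define B where "B = L * n powr \<beta> + C + 1"
    have B: "0 < B" using L C by (simp add: B_def add_nonneg_pos)
    define h where "h = (\<delta> / B) powr (1 / \<beta>)"
    have h: "0 < h" using \<delta> B by (simp add: h_def)
    have hB: "h powr \<beta> * B = \<delta>" using \<delta> B \<beta> by (simp add: h_def powr_powr)
    define a where "a = x - vec (h / 2)"
    define Q where "Q = box a (a + vec h)"
    have Q: "Q \<in> cubes" unfolding Q_def by (rule box_vec_in_cubes[OF h])
    have xQ: "x \<in> Q" using h by (auto simp: Q_def a_def mem_box_cart)
    have mQ: "measure lebesgue Q powr (\<beta> / real CARD('n)) = h powr \<beta>"
    proof -
      have "measure lebesgue Q = h ^ n" unfolding Q_def n_def using h by (intro measure_box_vec) auto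
      then show ?thesis using h n by (simp add: powr_realpow[symmetric] powr_powr n_def)
    qed
    have neg: "g y \<le> - \<delta>" if "y \<in> Q" for y
    proof -
      have "norm (y - x) \<le> n * h" using that xQ unfolding Q_def n_def by (rule norm_diff_box_vec)
      then have "norm (y - x) powr \<beta> \<le> (n * h) powr \<beta>" using \<beta> by (intro powr_mono2) auto
      then have "L * norm (y - x) powr \<beta> \<le> L * n powr \<beta> * h powr \<beta>"
        using L h by (simp add: powr_mult mult.assoc mult_left_mono)
      also have "\<dots> \<le> h powr \<beta> * B" using C h by (simp add: B_def algebra_simps)
      finally have "g y - g x \<le> \<delta>" using g[rule_format, of y x] hB by linarith
      then show ?thesis by (simp add: \<delta>_def)
    qed
    have "ennreal \<delta> \<le> average b Q"
      using bg neg \<delta> by (intro average_ge Q) (auto elim!: eventually_mono dest!: neg)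
    then have ge: "ennreal \<delta> \<le> local_maximal Q b y" if "y \<in> Q" for y
      using average_le_local_maximal[OF Q that, of Q b] by (auto intro: order_trans)
    have "ennreal (2 * \<delta>) \<le> average (\<lambda>x. b x - enn2real (local_maximal Q b x)) Q"
    proof (intro average_ge Q)
      show "AE y in lebesgue. y \<in> Q \<longrightarrow> 2 * \<delta> \<le> \<bar>b y - enn2real (local_maximal Q b y)\<bar>"
        using bg local_maximal_finite_AE[OF b Q]
      proof eventually_elim
        case (elim y)
        show ?case
        proof
          assume y: "y \<in> Q"
          then obtain v where v: "local_maximal Q b y = ennreal v" "0 \<le> v"
            using elim by (cases "local_maximal Q b y") auto
          then have "\<delta> \<le> v" using ge[OF y] by simp
          with neg[OF y] elim v show "2 * \<delta> \<le> \<bar>b y - enn2real (local_maximal Q b y)\<bar>" by simp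
        qed
      qed
    qed (use \<delta> in simp)
    also have "\<dots> \<le> ennreal (C * h powr \<beta>)" using avg[OF Q] unfolding mQ .
    finally have "2 * \<delta> \<le> C * h powr \<beta>" using C by (simp add: ennreal_le_iff)
    also have "\<dots> \<le> h powr \<beta> * B" using L h by (simp add: B_def algebra_simps)
    finally show False using hB \<delta> by simp
  qed
  with bg show ?thesis by (auto elim: eventually_mono)
qed

section \<open>Assembly of the equivalences\<close>

lemma Lipschitz_if_oscillation_finite:
  fixes b p q :: "real^'n \<Rightarrow> real"
  assumes b: "locally_integrable b" and \<beta>: "0 < \<beta>" "\<beta> < 1"
    and pq: "(p, q) \<in> exponent_pairs \<beta>" and osc: "oscillation \<beta> q b < \<infinity>"
  shows "b \<in> Lipschitz_space \<beta>" "AE x in lebesgue. 0 \<le> b x"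
proof -
  obtain C where C: "0 \<le> C" and avg: "\<forall>Q\<in>cubes. average (\<lambda>x. b x - enn2real (local_maximal Q b x)) Q
      \<le> ennreal (C * measure lebesgue Q powr (\<beta> / real CARD('n)))"
    using average_oscillation_bound[OF assms] by (elim exE conjE) (rule that)
  show lip: "b \<in> Lipschitz_space \<beta>"
  proof (rule Lipschitz_space_if_mean_deviation[OF b])
    fix Q :: "(real^'n) set" assume Q: "Q \<in> cubes"
    show "(LINT x:Q|lebesgue. \<bar>b x - mean b Q\<bar>)
        \<le> 2 * C * measure lebesgue Q powr (\<beta> / real CARD('n)) * measure lebesgue Q"
      using mean_deviation_le[OF b Q _ avg[rule_format, OF Q]] C by (simp add: mult.assoc)
  qed (use \<beta> C in auto)
  show "AE x in lebesgue. 0 \<le> b x"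
    by (rule nonneg_if_average_oscillation[OF b \<beta>(1) lip C]) (use avg in auto)
qed

theorem theorem1p2:
  fixes b :: "real^'n \<Rightarrow> real" and \<beta> :: real
  assumes "locally_integrable b" and "0 < \<beta>" and "\<beta> < 1"
  shows
    "let A1 = (b \<in> Lipschitz_space \<beta> \<and> (AE x in lebesgue. 0 \<le> b x));
         A2 = (\<forall>(p, q) \<in> exponent_pairs \<beta>. bounded_operator (commutator b) p q);
         A3 = (\<exists>(p, q) \<in> exponent_pairs \<beta>. bounded_operator (commutator b) p q);
         A4 = (\<exists>(p, q) \<in> exponent_pairs \<beta>. oscillation \<beta> q b < \<infinity>);
         A5 = (\<forall>(p, q) \<in> exponent_pairs \<beta>. oscillation \<beta> q b < \<infinity>)
     in (A1 \<longleftrightarrow> A2) \<and> (A2 \<longleftrightarrow> A3) \<and> (A3 \<longleftrightarrow> A4) \<and> (A4 \<longleftrightarrow> A5)"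
proof -
  define A1 where "A1 = (b \<in> Lipschitz_space \<beta> \<and> (AE x in lebesgue. 0 \<le> b x))"
  define A2 where "A2 = (\<forall>(p, q) \<in> exponent_pairs \<beta>. bounded_operator (commutator b) p q)"
  define A3 where "A3 = (\<exists>(p, q) \<in> exponent_pairs \<beta>. bounded_operator (commutator b) p q)"
  define A4 where "A4 = (\<exists>(p, q) \<in> exponent_pairs \<beta>. oscillation \<beta> q b < \<infinity>)"
  define A5 where "A5 = (\<forall>(p, q) \<in> exponent_pairs \<beta>. oscillation \<beta> q b < \<infinity>)"
  obtain p q where pq: "(p, q) \<in> (exponent_pairs \<beta> :: ((real^'n \<Rightarrow> real) \<times> (real^'n \<Rightarrow> real)) set)"
    using exponent_pairs_nonempty[OF assms(2,3), where 'n = 'n] by auto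
  \<comment> \<open>The cycle is A1, A2, A3, A4, A1; the assertion A5 is attached to it by A2 --> A5
    --> A4.\<close>
  have "A1 \<longrightarrow> A2"
    using commutator_bounded_if_Lipschitz[OF assms] by (auto simp: A1_def A2_def)
  moreover have "A2 \<longrightarrow> A3" "A5 \<longrightarrow> A4"
    using pq by (auto simp: A2_def A3_def A4_def A5_def)
  moreover have "A3 \<longrightarrow> A4" "A2 \<longrightarrow> A5"
    using oscillation_finite_if_bounded[OF assms] by (fastforce simp: A2_def A3_def A4_def A5_def)+
  moreover have "A4 \<longrightarrow> A1"
    using Lipschitz_if_oscillation_finite[OF assms] by (auto simp: A1_def A4_def)
  ultimately have "(A1 \<longleftrightarrow> A2) \<and> (A2 \<longleftrightarrow> A3) \<and> (A3 \<longleftrightarrow> A4) \<and> (A4 \<longleftrightarrow> A5)"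
    by blast
  then show ?thesis
    unfolding Let_def A1_def A2_def A3_def A4_def A5_def .
qed

end
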